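(* There is a constant $A \geq 0$ such that for every integer $N \geq 3$, $$L(N) \geq \frac{N}{(\log N)^A \exp\left[\frac{(\log \log N)^2}{\log 2}\right]}.$$
   Context: The divisor graph is the undirected graph whose vertices are the positive integers, with an edge $\{a,b\}$ whenever $a<b$ and $a$ divides $b$. A path of length $l$ in the divisor graph is a finite sequence $n_1,\dots,n_l$ of pairwise distinct positive integers such that for each $1\le i<l$, $n_i$ divides $n_{i+1}$ or $n_{i+1}$ divides $n_i$ (a single integer is a path of length 1). For real $x\ge 1$, $F(x)$ denotes the minimal number of paths in a partition of $\{1,2,\dots,\lfloor x\rfloor\}$ into paths of the divisor graph. A partition of $\{1,\dots,N\}$ into paths is called optimal if it consists of exactly $F(N)$ paths. $L(N)$ denotes the maximal length of a path, among all paths of all optimal partitions of $\{1,2,\dots,N\}$. *)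

theory Defs
  imports "HOL-Analysis.Analysis"
begin

definition divisor_edge :: "nat \<Rightarrow> nat \<Rightarrow> bool" where
  "divisor_edge a b \<longleftrightarrow> (a < b \<and> a dvd b) \<or> (b < a \<and> b dvd a)"

definition divisor_path :: "nat list \<Rightarrow> bool" where
  "divisor_path ns \<longleftrightarrow>
     ns \<noteq> [] \<and> (\<forall>n \<in> set ns. n > 0) \<and> distinct ns \<and>
     (\<forall>i. Suc i < length ns \<longrightarrow> divisor_edge (ns ! i) (ns ! Suc i))"

(* Consecutive entries are distinct, so the edge condition amounts to divisibility either way. *)
lemma divisor_path_iff_dvd:
  "divisor_path ns \<longleftrightarrow>
     ns \<noteq> [] \<and> (\<forall>n \<in> set ns. n > 0) \<and> distinct ns \<and>
     (\<forall>i. Suc i < length ns \<longrightarrow> ns ! i dvd ns ! Suc i \<or> ns ! Suc i dvd ns ! i)"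
proof -
  have "divisor_edge (ns ! i) (ns ! Suc i) \<longleftrightarrow> ns ! i dvd ns ! Suc i \<or> ns ! Suc i dvd ns ! i"
    if "distinct ns" "\<forall>n \<in> set ns. n > 0" "Suc i < length ns" for i
  proof -
    have "ns ! i \<noteq> ns ! Suc i" using that by (simp add: nth_eq_iff_index_eq)
    moreover have "ns ! i > 0" "ns ! Suc i > 0" using that by simp_all
    ultimately show ?thesis
      unfolding divisor_edge_def by (metis dvd_imp_le le_neq_implies_less)
  qed
  then show ?thesis unfolding divisor_path_def by blast
qed

(* Paths are nonempty, so disjointness of the vertex sets makes the collection finite
   (see path_partition_finite) and card below is a genuine count. *)
definition path_partition :: "nat \<Rightarrow> nat list set \<Rightarrow> bool" where
  "path_partition N P \<longleftrightarrow>
     (\<forall>p \<in> P. divisor_path p) \<and> disjoint_family_on set P \<and> (\<Union>p\<in>P. set p) = {1..N}"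

lemma path_partition_finite:
  assumes "path_partition N P"
  shows "finite P"
proof -
  have "inj_on set P"
    using assms unfolding path_partition_def divisor_path_def disjoint_family_on_def inj_on_def
    by (metis inf.idem set_empty)
  moreover have "set ` P \<subseteq> Pow {1..N}"
    using assms unfolding path_partition_def by blast
  ultimately show ?thesis by (meson finite_Pow_iff finite_atLeastAtMost finite_imageD finite_subset)
qed

lemma path_partition_singletons: "path_partition N ((\<lambda>n. [n]) ` {1..N})"
  by (auto simp: path_partition_def divisor_path_def disjoint_family_on_def)

definition F :: "real \<Rightarrow> nat" where
  "F x = (LEAST k. \<exists>P. path_partition (nat \<lfloor>x\<rfloor>) P \<and> card P = k)"

definition optimal_partition :: "nat \<Rightarrow> nat list set \<Rightarrow> bool" where
  "optimal_partition N P \<longleftrightarrow> path_partition N P \<and> card P = F (real N)"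

lemma optimal_partition_exists: "\<exists>P. optimal_partition N P"
proof -
  have "\<exists>k P. path_partition (nat \<lfloor>real N\<rfloor>) P \<and> card P = k"
    using path_partition_singletons by blast
  then have "\<exists>P. path_partition (nat \<lfloor>real N\<rfloor>) P \<and> card P = F (real N)"
    unfolding F_def by (rule LeastI_ex)
  then show ?thesis by (simp add: optimal_partition_def)
qed

definition optimal_lengths :: "nat \<Rightarrow> nat set" where
  "optimal_lengths N = {length p | p P. optimal_partition N P \<and> p \<in> P}"

definition L :: "nat \<Rightarrow> nat" where
  "L N = Max (optimal_lengths N)"

(* The maximum defining L is over a finite set, nonempty for positive N. *)
lemma optimal_lengths_finite: "finite (optimal_lengths N)"
proof (rule finite_subset)
  show "optimal_lengths N \<subseteq> {..N}"
  proof
    fix l assume "l \<in> optimal_lengths N"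
    then obtain p P where p: "l = length p" "path_partition N P" "p \<in> P"
      unfolding optimal_lengths_def optimal_partition_def by blast
    then have "distinct p" "set p \<subseteq> {1..N}"
      unfolding path_partition_def divisor_path_def by blast+
    then have "length p \<le> card {1..N}" by (metis card_mono distinct_card finite_atLeastAtMost)
    then show "l \<in> {..N}" using p by simp
  qed
qed simp

lemma optimal_lengths_nonempty:
  assumes "N \<ge> 1"
  shows "optimal_lengths N \<noteq> {}"
proof -
  obtain P where P: "optimal_partition N P" using optimal_partition_exists by blast
  then have "(\<Union>p\<in>P. set p) = {1..N}" by (simp add: optimal_partition_def path_partition_def)
  then obtain p where "p \<in> P" using assms by fastforce
  then show ?thesis using P unfolding optimal_lengths_def by blast
qed

end

theory Submission
  imports Defs "HOL-Number_Theory.Number_Theory" "HOL-Real_Asymp.Real_Asymp"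
begin

text \<open>
  For a prime \<open>p\<close> a little larger than \<open>sqrt N\<close> the multiples of \<open>p\<close> form a copy of the divisor graph
  on \<open>{1..y}\<close>, \<open>y = N div p\<close>, and are joined to other integers only through integers at most
  \<open>y\<close>. Taking \<open>p\<close> of order \<open>sqrt (N * ln N)\<close>, there are more such primes than edges at those small
  integers, so for many \<open>p\<close> an optimal partition never leaves the fibre of \<open>p\<close>, and its
  restriction to that fibre may be replaced by any optimal partition of \<open>{1..y}\<close>. By induction choose
  one containing a long path with an even end, and use \<open>2\<close> and \<open>1\<close> to prolong it so that it starts at
  a multiple of \<open>d\<close> and ends at a multiple of \<open>d'\<close>, for almost arbitrary primes \<open>d\<close>, \<open>d'\<close> of the
  order of \<open>y\<close>. Such primes \<open>d\<close> then glue the long paths of different fibres together. Detaching an integer from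
  its neighbours costs at most one path, and placing it between two paths gains one, so
  optimality is kept. With Chebyshev bounds this gives
  \<open>L N \<ge> c * N / (ln N)\<^sup>2 / R\<close> whenever \<open>L y \<ge> y / R\<close> for the relevant \<open>y \<le> sqrt N\<close>, and iterating
  this recursion gives the bound.
\<close>

section \<open>Primes between \<open>n\<close> and \<open>2 n\<close>\<close>

text \<open>By induction: \<open>ln (n + 1)\<close> is the sum of \<open>mangoldt\<close> over the
  divisors of \<open>n + 1\<close>, and these are exactly the \<open>d\<close> at which
  \<open>n div d\<close> grows by one. The free upper limit \<open>M\<close> lets the factorials in
  a binomial coefficient share one range of summation.\<close>

lemma ln_fact_conv_mangoldt:
  assumes "n \<le> M"
  shows "ln (fact n :: real) = (\<Sum>d\<in>{1..M}. mangoldt d * real (n div d))"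
  using assms
proof (induction n)
  case (Suc n)
  have split: "real (Suc n div d) = real (n div d) + (if d dvd Suc n then 1 else 0)" for d
    by (auto simp: div_Suc mod_eq_0_iff_dvd)
  have "(\<Sum>d | d dvd Suc n. mangoldt d :: real) = (\<Sum>d\<in>{1..M}. if d dvd Suc n then mangoldt d else 0)"
  proof (intro sum.mono_neutral_cong_left)
    show "{d. d dvd Suc n} \<subseteq> {1..M}"
    proof
      fix d assume "d \<in> {d. d dvd Suc n}"
      then have d: "d dvd Suc n" by simp
      then have "d \<le> Suc n" "d > 0" using dvd_imp_le[OF d] by (auto intro: Nat.gr0I)
      then show "d \<in> {1..M}" using Suc.prems by simp
    qed
  qed auto
  then have "ln (real (Suc n)) = (\<Sum>d\<in>{1..M}. if d dvd Suc n then mangoldt d else 0)"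
    using mangoldt_sum[of "Suc n", where ?'a = real] by simp
  moreover have "ln (fact (Suc n) :: real) = ln (real (Suc n)) + ln (fact n)"
    by (simp add: ln_mult)
  ultimately show ?case
    using Suc by (auto simp: split algebra_simps sum.distrib intro!: sum.cong)
qed simp

lemma ln_binomial_conv_mangoldt:
  assumes "k \<le> n"
  shows "ln (real (n choose k)) =
    (\<Sum>d\<in>{1..n}. mangoldt d * (real (n div d) - real (k div d) - real ((n - k) div d)))"
proof -
  have "ln (real (n choose k)) = ln (fact n) - ln (fact k) - ln (fact (n - k) :: real)"
    using assms by (subst binomial_fact) (auto simp: ln_div ln_mult)
  then show ?thesis
    using assms by (simp add: ln_fact_conv_mangoldt[of _ n] sum_subtractf right_diff_distrib)
qed

section \<open>Bounds for Chebyshev's psi function\<close>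

definition chebyshev_psi :: "nat \<Rightarrow> real" where
  "chebyshev_psi n = (\<Sum>d\<in>{1..n}. mangoldt d)"

lemma chebyshev_psi_diff:
  assumes "m \<le> n"
  shows "chebyshev_psi n - chebyshev_psi m = (\<Sum>d\<in>{m<..n}. mangoldt d)"
proof -
  have "{1..n} = {1..m} \<union> {m<..n}" using assms by auto
  then have "chebyshev_psi n = chebyshev_psi m + (\<Sum>d\<in>{m<..n}. mangoldt d)"
    unfolding chebyshev_psi_def by (metis (no_types) disjoint_iff finite_atLeastAtMost
      finite_greaterThanAtMost atLeastAtMost_iff greaterThanAtMost_iff leD sum.union_disjoint)
  then show ?thesis by simp
qed

lemma div_add_div_le: "a div d + b div d \<le> (a + b) div (d::nat)"
  by (subst div_add1_eq) simp

text \<open>In the expansion of the middle binomial coefficient no weight is negative, and in the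
  upper half of \<open>{1..n}\<close> the weight is at least \<open>1\<close>, because there both
  subtracted quotients vanish.\<close>

lemma chebyshev_psi_half:
  "chebyshev_psi n - chebyshev_psi (n - n div 2) \<le> ln (real (n choose (n div 2)))"
proof -
  let ?k = "n div 2"
  let ?e = "\<lambda>d. real (n div d) - real (?k div d) - real ((n - ?k) div d)"
  have e0: "?e d \<ge> 0" for d
    using div_add_div_le[of ?k d "n - ?k"] by (simp flip: of_nat_add)
  have e1: "1 \<le> ?e d" if "d \<in> {n - ?k<..n}" for d
  proof -
    have "?k div d = 0" "(n - ?k) div d = 0" "1 \<le> n div d"
      using that by (auto simp: div_greater_zero_iff Suc_le_eq)
    then show ?thesis by simp
  qed
  have "chebyshev_psi n - chebyshev_psi (n - ?k) = (\<Sum>d\<in>{n-?k<..n}. mangoldt d)"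
    by (intro chebyshev_psi_diff) auto
  also have "\<dots> \<le> (\<Sum>d\<in>{n-?k<..n}. mangoldt d * ?e d)"
    by (intro sum_mono) (metis e1 mangoldt_nonneg mult_left_mono mult.right_neutral)
  also have "\<dots> \<le> (\<Sum>d\<in>{1..n}. mangoldt d * ?e d)"
    by (intro sum_mono2) (auto intro!: mult_nonneg_nonneg e0 mangoldt_nonneg)
  also have "\<dots> = ln (real (n choose ?k))"
    by (subst ln_binomial_conv_mangoldt) auto
  finally show ?thesis .
qed

text \<open>Passing from \<open>n\<close> to \<open>n - k\<close> with \<open>k = n div 2\<close>
  costs at most \<open>k * ln 4\<close>, the logarithm of the bound \<open>4 ^ k\<close> for the
  middle binomial coefficient.\<close>

lemma chebyshev_psi_le: "chebyshev_psi n \<le> real n * ln 4"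
proof (induction n rule: less_induct)
  case (less n)
  show ?case
  proof (cases "n \<le> 1")
    case True
    then consider "n = 0" | "n = 1" by linarith
    then show ?thesis by cases (auto simp: chebyshev_psi_def)
  next
    case False
    define k where "k = n div 2"
    have ln4: "ln 4 = 2 * ln (2::real)" using ln_realpow[of 2 2] by simp
    have pos: "n choose k > 0" unfolding k_def by simp
    have IH: "chebyshev_psi (n - k) \<le> real (n - k) * ln 4"
      using False by (intro less) (auto simp: k_def)
    have "ln (real (n choose k)) \<le> real k * ln 4"
    proof (cases "even n")
      case True
      then have "n = 2 * k" by (simp add: k_def)
      then have "n choose k \<le> 4 ^ k"
        using binomial_le_pow2[of n k] by (simp add: power_mult)
      then have "real (n choose k) \<le> 4 ^ k" by (metis of_nat_le_iff of_nat_numeral of_nat_power)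
      then have "ln (real (n choose k)) \<le> ln (4 ^ k)" using pos by (subst ln_le_cancel_iff) auto
      then show ?thesis by (simp add: ln_realpow)
    next
      case False
      then have n: "n = 2 * k + 1" by (simp add: k_def)
      \<comment> \<open>For odd \<open>n\<close> the two middle coefficients agree, so twice one of
        them is at most \<open>2 ^ n = 2 * 4 ^ k\<close>.\<close>
      have "n choose (k + 1) = n choose k"
        using n by (metis Suc_eq_plus1 add_diff_cancel_left' binomial_symmetric mult_2 le_add1 add_Suc_right add.assoc)
      moreover have "(\<Sum>i\<in>{k,k+1}. n choose i) \<le> (\<Sum>i\<le>n. n choose i)"
        using n by (intro sum_mono2) auto
      ultimately have "2 * (n choose k) \<le> 2 ^ n" by (simp add: choose_row_sum)
      then have "n choose k \<le> 4 ^ k" using n by (simp add: power_mult)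
      then have "real (n choose k) \<le> 4 ^ k" by (metis of_nat_le_iff of_nat_numeral of_nat_power)
      then have "ln (real (n choose k)) \<le> ln (4 ^ k)" using pos by (subst ln_le_cancel_iff) auto
      then show ?thesis by (simp add: ln_realpow)
    qed
    with IH chebyshev_psi_half[of n] have "chebyshev_psi n \<le> (real (n - k) + real k) * ln 4"
      by (simp add: k_def algebra_simps)
    then show ?thesis by (simp add: k_def flip: of_nat_add)
  qed
qed

text \<open>No \<open>d\<close> with \<open>2 n / 3 < d \<le> n\<close> contributes to the central binomial coefficient, which
  is what makes the interval \<open>(n, 2 n]\<close> retain a positive proportion.\<close>

lemma chebyshev_psi_diff_ge:
  assumes "n > 0"
  shows "real n * ln 4 / 3 - ln (2 * real n) \<le> chebyshev_psi (2 * n) - chebyshev_psi n"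
proof -
  let ?e = "\<lambda>d. real (2 * n div d) - real (n div d) - real (n div d)"
  let ?m = "2 * n div 3"
  have e1: "?e d \<le> 1" if "d > 0" for d
  proof -
    have "2 * n < (2 * (n div d) + 2) * d"
      using dividend_less_div_times[OF that, of n] by (simp add: algebra_simps)
    then have "2 * n div d < 2 * (n div d) + 2" by (rule less_mult_imp_div_less)
    then show ?thesis by linarith
  qed
  have e0: "?e d = 0" if "d \<in> {?m<..n}" for d
  proof -
    have "n div d = 1" "2 * n div d = 2" using that by (auto intro!: div_nat_eqI)
    then show ?thesis by simp
  qed
  have "4 ^ n / (2 * real n) \<le> real (2 * n choose n)"
    using central_binomial_lower_bound[OF assms] by simp
  then have "ln (4 ^ n / (2 * real n)) \<le> ln (real (2 * n choose n))"
    using assms by (subst ln_le_cancel_iff) auto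
  also have "\<dots> = (\<Sum>d\<in>{1..2*n}. mangoldt d * ?e d)"
    by (subst ln_binomial_conv_mangoldt) auto
  also have "{1..2*n} = {1..?m} \<union> {?m<..n} \<union> {n<..2*n}" by auto
  also have "(\<Sum>d\<in>\<dots>. mangoldt d * ?e d) = (\<Sum>d\<in>{1..?m}. mangoldt d * ?e d) +
      (\<Sum>d\<in>{?m<..n}. mangoldt d * ?e d) + (\<Sum>d\<in>{n<..2*n}. mangoldt d * ?e d)"
    using assms by (subst sum.union_disjoint; (subst sum.union_disjoint)?) auto
  also have "(\<Sum>d\<in>{?m<..n}. mangoldt d * ?e d) = 0"
    by (intro sum.neutral) (use e0 in auto)
  also have "(\<Sum>d\<in>{1..?m}. mangoldt d * ?e d) \<le> (\<Sum>d\<in>{1..?m}. mangoldt d)"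
    by (intro sum_mono mult_left_le e1 mangoldt_nonneg) auto
  also have "(\<Sum>d\<in>{n<..2*n}. mangoldt d * ?e d) \<le> (\<Sum>d\<in>{n<..2*n}. mangoldt d)"
    by (intro sum_mono mult_left_le e1 mangoldt_nonneg) auto
  finally have "ln (4 ^ n / (2 * real n)) \<le>
      chebyshev_psi ?m + (chebyshev_psi (2 * n) - chebyshev_psi n)"
    by (subst chebyshev_psi_diff) (auto simp: chebyshev_psi_def)
  \<comment> \<open>Two thirds of the main term \<open>n * ln 4\<close> are given away here; the
    remaining third is the gain.\<close>
  moreover have "chebyshev_psi ?m \<le> (2 * real n / 3) * ln 4"
    by (rule order.trans[OF chebyshev_psi_le mult_right_mono]) auto
  moreover have "ln (4 ^ n / (2 * real n)) = real n * ln 4 - ln (2 * real n)"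
    using assms by (simp add: ln_div ln_realpow)
  ultimately show ?thesis by (simp add: field_simps)
qed

text \<open>Successive powers of a prime differ by a factor of at least \<open>2\<close>, so
  \<open>(n, 2 n]\<close> holds at most one power of each prime; the base of a proper power is at
  most \<open>sqrt (2 n)\<close>.\<close>

lemma card_primepow_not_prime_le:
  "card {d \<in> {n<..2*n}. primepow d \<and> \<not> prime d} \<le> sqrt (2 * real n)"
proof -
  let ?A = "{d \<in> {n<..2*n}. primepow d \<and> \<not> prime d}"
  have rep: "\<exists>k\<ge>2. d = aprimedivisor d ^ k \<and> prime (aprimedivisor d)" if "d \<in> ?A" for d
  proof -
    from that obtain p k where pk: "prime p" "k > 0" "d = p ^ k" by (auto simp: primepow_def)
    moreover have "k \<noteq> 1" using pk that by auto
    ultimately show ?thesis by (intro exI[of _ k]) (auto simp: aprimedivisor_prime_power)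
  qed
  have "inj_on aprimedivisor ?A"
  proof (rule inj_onI)
    fix d d' assume d: "d \<in> ?A" "d' \<in> ?A" "aprimedivisor d = aprimedivisor d'"
    define p where "p = aprimedivisor d"
    obtain k k' where k: "d = p ^ k" "d' = p ^ k'" and p: "prime p"
      using rep[OF d(1)] rep[OF d(2)] d(3) unfolding p_def by metis
    have aux: False if "i < j" "n < p ^ i" "p ^ j \<le> 2 * n" for i j
    proof -
      have "2 * p ^ i \<le> p ^ Suc i" using prime_ge_2_nat[OF p] by simp
      also have "\<dots> \<le> p ^ j" using that prime_gt_0_nat[OF p] by (intro power_increasing) auto
      finally show False using that by linarith
    qed
    have "k = k'"
      using aux[of k k'] aux[of k' k] d k by (metis (lifting) greaterThanAtMost_iff mem_Collect_eq nat_neq_iff)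
    then show "d = d'" using k by simp
  qed
  moreover have "aprimedivisor ` ?A \<subseteq> {1..nat \<lfloor>sqrt (2 * real n)\<rfloor>}"
  proof
    fix p assume "p \<in> aprimedivisor ` ?A"
    then obtain d k where d: "d \<in> ?A" "p = aprimedivisor d" "k \<ge> 2" "d = p ^ k" "prime p"
      using rep by blast
    have "p ^ 2 \<le> p ^ k" using d(3) prime_gt_0_nat[OF d(5)] by (intro power_increasing) auto
    then have "p ^ 2 \<le> 2 * n" using d(1) unfolding d(4)[symmetric] by simp
    then have "real p ^ 2 \<le> 2 * real n" by (metis of_nat_le_iff of_nat_mult of_nat_numeral of_nat_power)
    then have "real p \<le> sqrt (2 * real n)" by (simp add: real_le_rsqrt)
    then show "p \<in> {1..nat \<lfloor>sqrt (2 * real n)\<rfloor>}"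
      using prime_gt_0_nat[OF d(5)] by (auto simp: Suc_le_eq le_nat_floor)
  qed
  ultimately have "card ?A \<le> nat \<lfloor>sqrt (2 * real n)\<rfloor>"
    using card_inj_on_le[of aprimedivisor ?A "{1..nat \<lfloor>sqrt (2 * real n)\<rfloor>}"] by simp
  then show ?thesis
    by (simp add: le_nat_iff le_floor_iff)
qed

lemma chebyshev_psi_diff_le:
  assumes "n > 0"
  shows "chebyshev_psi (2 * n) - chebyshev_psi n \<le>
    (real (card {p \<in> {n<..2*n}. prime p}) + sqrt (2 * real n)) * ln (2 * real n)"
proof -
  let ?A = "{d \<in> {n<..2*n}. primepow d \<and> \<not> prime d}" and ?B = "{p \<in> {n<..2*n}. prime p}"
  have "chebyshev_psi (2 * n) - chebyshev_psi n = (\<Sum>d\<in>{n<..2*n}. mangoldt d)"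
    by (intro chebyshev_psi_diff) auto
  also have "\<dots> = (\<Sum>d\<in>?A \<union> ?B. mangoldt d)"
    by (intro sum.mono_neutral_right) (auto simp: mangoldt_def)
  also have "\<dots> \<le> real (card (?A \<union> ?B)) * ln (2 * real n)"
  proof (rule sum_bounded_above)
    fix d assume d: "d \<in> ?A \<union> ?B"
    then have "mangoldt d \<le> ln (real d)" by (intro mangoldt_le) auto
    also have "\<dots> \<le> ln (2 * real n)" using d assms by (subst ln_le_cancel_iff) auto
    finally show "mangoldt d \<le> ln (2 * real n)" .
  qed
  also have "card (?A \<union> ?B) = card ?A + card ?B" by (rule card_Un_disjoint) auto
  also have "real (card ?A + card ?B) * ln (2 * real n) \<le>
      (real (card ?B) + sqrt (2 * real n)) * ln (2 * real n)"
    using card_primepow_not_prime_le[of n] assms by (intro mult_right_mono) auto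
  finally show ?thesis .
qed

text \<open>The two bounds for the psi difference give about \<open>n / (3 * ln n)\<close>;
  replacing \<open>3\<close> by \<open>10\<close> absorbs the square root and the
  logarithms.\<close>

lemma eventually_card_primes_ge:
  "\<forall>\<^sub>F n in sequentially. real n / (10 * ln (real n)) \<le> real (card {p \<in> {n<..2*n}. prime p})"
proof -
  have "\<forall>\<^sub>F n in sequentially.
      real n / (10 * ln (real n)) \<le> (real n / 3 - ln (2 * real n)) / ln (2 * real n) - sqrt (2 * real n)"
    by real_asymp
  then show ?thesis
    using eventually_gt_at_top[of 0]
  proof eventually_elim
    case (elim n)
    have ln4: "1 \<le> ln (4::real)"
      using exp_le by (subst ln_ge_iff) auto
    have pos: "ln (2 * real n) > 0" using elim by (intro ln_gt_zero) auto
    have "real n / 3 - ln (2 * real n) \<le> real n * ln 4 / 3 - ln (2 * real n)"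
      using ln4 elim by (simp add: mult_le_cancel_left1)
    also have "\<dots> \<le> (real (card {p \<in> {n<..2*n}. prime p}) + sqrt (2 * real n)) * ln (2 * real n)"
      using chebyshev_psi_diff_ge[of n] chebyshev_psi_diff_le[of n] elim by linarith
    finally have "(real n / 3 - ln (2 * real n)) / ln (2 * real n) \<le>
        real (card {p \<in> {n<..2*n}. prime p}) + sqrt (2 * real n)"
      using pos by (simp add: field_simps)
    with elim show ?case by linarith
  qed
qed

section \<open>Path partitions and their surgery\<close>

text \<open>\<open>path_partition\<close> for an arbitrary vertex set, so that families of paths can
  be restricted, removed and joined.\<close>

definition paths_on :: "nat set \<Rightarrow> nat list set \<Rightarrow> bool" where
  "paths_on S P \<longleftrightarrow>
     (\<forall>p\<in>P. divisor_path p) \<and> disjoint_family_on set P \<and> (\<Union>p\<in>P. set p) = S"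

lemma path_partition_conv: "path_partition N P \<longleftrightarrow> paths_on {1..N} P"
  by (simp add: path_partition_def paths_on_def)

lemma divisor_path_conv:
  "divisor_path ns \<longleftrightarrow> ns \<noteq> [] \<and> 0 \<notin> set ns \<and> distinct ns \<and> successively divisor_edge ns"
  unfolding divisor_path_def successively_conv_nth by (auto intro: Nat.gr0I)

lemma divisor_edge_sym: "divisor_edge a b \<longleftrightarrow> divisor_edge b a"
  by (auto simp: divisor_edge_def)

lemma divisor_edge_mult: "k > 0 \<Longrightarrow> divisor_edge (k * a) (k * b) \<longleftrightarrow> divisor_edge a b"
  by (auto simp: divisor_edge_def)

lemma divisor_path_rev: "divisor_path (rev p) \<longleftrightarrow> divisor_path p"
proof -
  have "(\<lambda>x y. divisor_edge y x) = divisor_edge" by (intro ext divisor_edge_sym)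
  then show ?thesis by (simp only: divisor_path_conv successively_rev set_rev distinct_rev rev_is_Nil_conv)
qed

lemma divisor_path_map_mult:
  "k > 0 \<Longrightarrow> divisor_path (map ((*) k) p) \<longleftrightarrow> divisor_path p"
  by (auto simp: divisor_path_conv distinct_map successively_map divisor_edge_mult inj_on_def)

lemma divisor_path_append_iff:
  assumes "xs \<noteq> []" "ys \<noteq> []"
  shows "divisor_path (xs @ ys) \<longleftrightarrow> divisor_path xs \<and> divisor_path ys \<and>
    set xs \<inter> set ys = {} \<and> divisor_edge (last xs) (hd ys)"
  using assms by (auto simp: divisor_path_conv successively_append_iff)

lemma paths_on_finite:
  assumes "paths_on S P" "finite S"
  shows "finite P"
proof -
  have "inj_on set P"
    using assms unfolding paths_on_def divisor_path_def disjoint_family_on_def inj_on_def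
    by (metis inf.idem set_empty)
  moreover have "set ` P \<subseteq> Pow S" using assms unfolding paths_on_def by blast
  ultimately show ?thesis by (meson assms(2) finite_Pow_iff finite_imageD finite_subset)
qed

lemma paths_on_path: "paths_on S P \<Longrightarrow> p \<in> P \<Longrightarrow> divisor_path p"
  by (simp add: paths_on_def)

lemma paths_on_subset: "paths_on S P \<Longrightarrow> p \<in> P \<Longrightarrow> set p \<subseteq> S"
  by (auto simp: paths_on_def)

lemma paths_on_disjoint:
  "paths_on S P \<Longrightarrow> p \<in> P \<Longrightarrow> q \<in> P \<Longrightarrow> x \<in> set p \<Longrightarrow> x \<in> set q \<Longrightarrow> p = q"
  unfolding paths_on_def disjoint_family_on_def by blast

lemma paths_on_ex: "paths_on S P \<Longrightarrow> x \<in> S \<Longrightarrow> \<exists>p\<in>P. x \<in> set p"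
  unfolding paths_on_def by blast

lemma paths_on_sub: "paths_on S P \<Longrightarrow> Q \<subseteq> P \<Longrightarrow> paths_on (\<Union>(set ` Q)) Q"
  unfolding paths_on_def using disjoint_family_on_mono by blast

lemma paths_on_Diff:
  assumes "paths_on S P" "R \<subseteq> P"
  shows "paths_on (S - \<Union>(set ` R)) (P - R)"
proof -
  have "\<Union>(set ` (P - R)) = S - \<Union>(set ` R)"
  proof (intro equalityI subsetI)
    fix x assume "x \<in> \<Union>(set ` (P - R))"
    then obtain p where p: "p \<in> P" "p \<notin> R" "x \<in> set p" by blast
    then have "x \<in> S" using paths_on_subset[OF assms(1)] by blast
    moreover have "x \<notin> set q" if "q \<in> R" for q
      using paths_on_disjoint[OF assms(1) p(1) _ p(3), of q] that p(2) assms(2) by blast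
    ultimately show "x \<in> S - \<Union>(set ` R)" by blast
  next
    fix x assume "x \<in> S - \<Union>(set ` R)"
    then show "x \<in> \<Union>(set ` (P - R))" using paths_on_ex[OF assms(1)] by blast
  qed
  then show ?thesis using paths_on_sub[OF assms(1), of "P - R"] by auto
qed

lemma paths_on_Un:
  assumes "paths_on S P" "paths_on T Q" "S \<inter> T = {}"
  shows "paths_on (S \<union> T) (P \<union> Q)"
proof -
  have "disjoint_family_on set (P \<union> Q)"
    unfolding disjoint_family_on_def
  proof (intro ballI impI)
    fix p q assume pq: "p \<in> P \<union> Q" "q \<in> P \<union> Q" "p \<noteq> q"
    have "set p \<inter> set q = {}" if "p \<in> P" "q \<in> P"
      using paths_on_disjoint[OF assms(1) that] pq(3) by blast
    moreover have "set p \<inter> set q = {}" if "p \<in> Q" "q \<in> Q"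
      using paths_on_disjoint[OF assms(2) that] pq(3) by blast
    moreover have "set p \<inter> set q = {}" if "p \<in> P" "q \<in> Q"
      using paths_on_subset[OF assms(1) that(1)] paths_on_subset[OF assms(2) that(2)] assms(3) by blast
    moreover have "set p \<inter> set q = {}" if "p \<in> Q" "q \<in> P"
      using paths_on_subset[OF assms(2) that(1)] paths_on_subset[OF assms(1) that(2)] assms(3) by blast
    ultimately show "set p \<inter> set q = {}" using pq(1,2) by blast
  qed
  then show ?thesis using assms(1,2) unfolding paths_on_def by auto
qed

lemma paths_on_UN:
  assumes "\<And>i. i \<in> I \<Longrightarrow> paths_on (S i) (P i)" "disjoint_family_on S I"
  shows "paths_on (\<Union>i\<in>I. S i) (\<Union>i\<in>I. P i)"
  unfolding paths_on_def
proof (intro conjI)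
  show "\<forall>p\<in>(\<Union>i\<in>I. P i). divisor_path p" using assms(1) paths_on_path by blast
  show "(\<Union>p\<in>(\<Union>i\<in>I. P i). set p) = (\<Union>i\<in>I. S i)"
    using assms(1) unfolding paths_on_def by blast
  show "disjoint_family_on set (\<Union>i\<in>I. P i)"
    unfolding disjoint_family_on_def
  proof (intro ballI impI)
    fix p q assume "p \<in> (\<Union>i\<in>I. P i)" "q \<in> (\<Union>i\<in>I. P i)" "p \<noteq> q"
    then obtain i j where ij: "i \<in> I" "p \<in> P i" "j \<in> I" "q \<in> P j" by blast
    show "set p \<inter> set q = {}"
    proof (cases "i = j")
      case True
      then show ?thesis using ij \<open>p \<noteq> q\<close> paths_on_disjoint[OF assms(1)[of i]] by blast
    next
      case False
      then have "S i \<inter> S j = {}" using assms(2) ij by (auto simp: disjoint_family_on_def)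
      then show ?thesis
        using paths_on_subset[OF assms(1)] ij by blast
    qed
  qed
qed

lemma paths_on_map_mult:
  assumes "paths_on S P" "k > 0"
  shows "paths_on ((*) k ` S) (map ((*) k) ` P)"
  unfolding paths_on_def
proof (intro conjI)
  show "\<forall>p\<in>map ((*) k) ` P. divisor_path p"
    using assms by (auto simp: divisor_path_map_mult paths_on_def)
  show "(\<Union>p\<in>map ((*) k) ` P. set p) = (*) k ` S"
    using assms(1) unfolding paths_on_def by (simp add: image_UN) blast
  show "disjoint_family_on set (map ((*) k) ` P)"
    unfolding disjoint_family_on_def
  proof (intro ballI impI)
    fix a b assume "a \<in> map ((*) k) ` P" "b \<in> map ((*) k) ` P" "a \<noteq> b"
    then obtain p q where pq: "p \<in> P" "q \<in> P" "a = map ((*) k) p" "b = map ((*) k) q" "p \<noteq> q"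
      by blast
    have "set p \<inter> set q = {}" using paths_on_disjoint[OF assms(1) pq(1,2)] pq(5) by blast
    then show "set a \<inter> set b = {}"
      using assms(2) unfolding pq(3,4) by (auto simp: disjoint_iff)
  qed
qed

text \<open>Cutting \<open>v\<close> out of its path leaves at most two pieces, empty ones being
  discarded. The survival of all other paths is what allows them to be glued afterwards.\<close>

lemma paths_on_remove_vertex:
  assumes P: "paths_on S P" "finite S" and v: "v \<in> S"
  shows "\<exists>P'. paths_on (S - {v}) P' \<and> card P' \<le> Suc (card P) \<and> (\<forall>p\<in>P. v \<notin> set p \<longrightarrow> p \<in> P')"
proof -
  obtain p where p: "p \<in> P" "v \<in> set p" using paths_on_ex[OF P(1) v] by blast
  obtain xs ys where xy: "p = xs @ v # ys" using p(2) split_list by metis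
  let ?N = "{xs, ys} - {[]}"
  let ?P' = "(P - {p}) \<union> ?N"
  have dp: "divisor_path (xs @ v # ys)" using paths_on_path[OF P(1) p(1)] xy by simp
  have N: "paths_on (set p - {v}) ?N"
    using dp by (auto simp: xy paths_on_def disjoint_family_on_def divisor_path_conv
        successively_append_iff successively_Cons)
  have rest: "paths_on (S - set p) (P - {p})"
    using paths_on_Diff[OF P(1), of "{p}"] p(1) by simp
  have "(S - set p) \<union> (set p - {v}) = S - {v}"
    using paths_on_subset[OF P(1) p(1)] p(2) by blast
  then have "paths_on (S - {v}) ?P'"
    using paths_on_Un[OF rest N] by (metis Diff_iff disjoint_iff)
  moreover have "card ?P' \<le> Suc (card P)"
  proof -
    have fin: "finite P" by (rule paths_on_finite[OF P])
    have "card ?P' \<le> card (P - {p}) + card ?N" by (rule card_Un_le)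
    moreover have "card ?N \<le> card {xs, ys}" by (intro card_mono) auto
    moreover have "card {xs, ys} \<le> 2" by (simp add: card_insert_if)
    moreover have "card (P - {p}) = card P - 1" "card P > 0"
      using fin p(1) by (auto simp: card_gt_0_iff)
    ultimately show ?thesis by linarith
  qed
  moreover have "\<forall>q\<in>P. v \<notin> set q \<longrightarrow> q \<in> ?P'" using p by blast
  ultimately show ?thesis by blast
qed

lemma paths_on_remove:
  assumes "paths_on S P" "finite S" "T \<subseteq> S"
  shows "\<exists>P'. paths_on (S - T) P' \<and> card P' \<le> card P + card T \<and>
    (\<forall>p\<in>P. set p \<inter> T = {} \<longrightarrow> p \<in> P')"
proof -
  have "finite T" using assms finite_subset by blast
  then show ?thesis using assms(3)
  proof (induction T rule: finite_induct)
    case empty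
    then show ?case using assms(1) by (intro exI[of _ P]) auto
  next
    case (insert v T)
    then obtain P' where P': "paths_on (S - T) P'" "card P' \<le> card P + card T"
      "\<forall>p\<in>P. set p \<inter> T = {} \<longrightarrow> p \<in> P'" by auto
    have "v \<in> S - T" using insert by auto
    from paths_on_remove_vertex[OF P'(1) _ this] obtain P''
      where P'': "paths_on (S - T - {v}) P''" "card P'' \<le> Suc (card P')"
        "\<forall>p\<in>P'. v \<notin> set p \<longrightarrow> p \<in> P''" using assms(2) by auto
    have "S - T - {v} = S - insert v T" by blast
    then show ?case using P' P'' insert by (intro exI[of _ P'']) auto
  qed
qed

text \<open>Freeing the vertices of \<open>T\<close> creates at most \<open>card T\<close> new paths, and gluing
  \<open>card T + 1\<close> paths together with \<open>T\<close> saves as many.\<close>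

lemma paths_on_surgery:
  assumes P: "paths_on S P" "finite S" and T: "T \<subseteq> S" and R: "R \<subseteq> P"
    and RT: "\<And>r. r \<in> R \<Longrightarrow> set r \<inter> T = {}" and card: "card R = Suc (card T)"
    and X: "divisor_path X" "set X = T \<union> (\<Union>r\<in>R. set r)"
  shows "\<exists>P'. paths_on S P' \<and> card P' \<le> card P \<and> X \<in> P'"
proof -
  obtain P1 where P1: "paths_on (S - T) P1" "card P1 \<le> card P + card T"
    "\<forall>p\<in>P. set p \<inter> T = {} \<longrightarrow> p \<in> P1"
    using paths_on_remove[OF P T] by blast
  have RP1: "R \<subseteq> P1" using R RT P1(3) by blast
  have fin: "finite P1" using paths_on_finite[OF P1(1)] P(2) by auto
  have "S - T - \<Union>(set ` R) = S - set X" unfolding X(2) by blast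
  then have "paths_on (S - set X) (P1 - R)" using paths_on_Diff[OF P1(1) RP1] by simp
  moreover have "paths_on (set X) {X}"
    using X(1) by (auto simp: paths_on_def disjoint_family_on_def)
  ultimately have "paths_on (S - set X \<union> set X) (P1 - R \<union> {X})" by (rule paths_on_Un) auto
  moreover have "S - set X \<union> set X = S"
    using T paths_on_subset[OF P(1)] R unfolding X(2) by blast
  moreover have "card (P1 - R \<union> {X}) \<le> card P"
  proof -
    have "card (P1 - R \<union> {X}) \<le> card (P1 - R) + card {X}" by (rule card_Un_le)
    also have "card (P1 - R) = card P1 - card R"
      using RP1 fin by (intro card_Diff_subset) (auto intro: finite_subset)
    moreover have "card R \<le> card P1" using RP1 fin by (intro card_mono) auto
    ultimately show ?thesis using P1(2) card by simp
  qed
  ultimately show ?thesis by (intro exI[of _ "P1 - R \<union> {X}"]) auto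
qed

section \<open>Fibres of primes\<close>

definition adjacent_in :: "nat list set \<Rightarrow> nat \<Rightarrow> nat \<Rightarrow> bool" where
  "adjacent_in P x y \<longleftrightarrow> (\<exists>p\<in>P. \<exists>us vs. p = us @ x # y # vs \<or> p = us @ y # x # vs)"

lemma adjacent_in_sym: "adjacent_in P x y \<longleftrightarrow> adjacent_in P y x"
  unfolding adjacent_in_def by blast

lemma adjacent_inD:
  assumes "paths_on S P" "adjacent_in P x y"
  shows "divisor_edge x y" "x \<in> S" "y \<in> S"
proof -
  obtain p us vs where p: "p \<in> P" "p = us @ x # y # vs \<or> p = us @ y # x # vs"
    using assms(2) unfolding adjacent_in_def by blast
  have "divisor_path p" "set p \<subseteq> S" using assms(1) p(1) paths_on_path paths_on_subset by auto
  then show "divisor_edge x y" "x \<in> S" "y \<in> S"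
    using p(2) by (auto simp: divisor_path_conv successively_append_iff divisor_edge_def)
qed

lemma card_adjacent_le:
  assumes "paths_on S P" "finite S"
  shows "finite {y. adjacent_in P x y}" "card {y. adjacent_in P x y} \<le> 2"
proof -
  have "\<exists>a b. {y. adjacent_in P x y} \<subseteq> {a, b}"
  proof (cases "x \<in> S")
    case False
    then show ?thesis using adjacent_inD[OF assms(1)] by blast
  next
    case True
    then obtain p where p: "p \<in> P" "x \<in> set p" using paths_on_ex[OF assms(1)] by blast
    obtain us vs where uv: "p = us @ x # vs" using p(2) split_list by metis
    have dist: "distinct p" using paths_on_path[OF assms(1) p(1)] by (simp add: divisor_path_conv)
    \<comment> \<open>If \<open>us\<close> or \<open>vs\<close> is empty, its \<open>last\<close> or
      \<open>hd\<close> is an unspecified value. This is harmless, since only an inclusion in a set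
      of two elements is wanted.\<close>
    have "y \<in> {last us, hd vs}" if adj: "adjacent_in P x y" for y
    proof -
      obtain q us' vs' where q: "q \<in> P" "q = us' @ x # y # vs' \<or> q = us' @ y # x # vs'"
        using adj unfolding adjacent_in_def by blast
      then have "x \<in> set q" by auto
      then have "q = p" using paths_on_disjoint[OF assms(1) q(1) p(1)] p(2) by blast
      from q(2) show ?thesis
      proof
        assume "q = us' @ x # y # vs'"
        then have "us @ x # vs = us' @ x # y # vs'" using \<open>q = p\<close> uv by simp
        then have "vs = y # vs'"
          using dist unfolding uv by (subst (asm) append_Cons_eq_iff) auto
        then show ?thesis by simp
      next
        assume "q = us' @ y # x # vs'"
        then have "us @ x # vs = (us' @ [y]) @ x # vs'" using \<open>q = p\<close> uv by simp
        then have "us = us' @ [y]"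
          using dist unfolding uv by (subst (asm) append_Cons_eq_iff) auto
        then show ?thesis by simp
      qed
    qed
    then show ?thesis by blast
  qed
  then obtain a b where ab: "{y. adjacent_in P x y} \<subseteq> {a, b}" by blast
  then show "finite {y. adjacent_in P x y}" using finite_subset by blast
  have "card {y. adjacent_in P x y} \<le> card {a, b}" using ab by (intro card_mono) auto
  also have "\<dots> \<le> 2" by (simp add: card_insert_if)
  finally show "card {y. adjacent_in P x y} \<le> 2" .
qed

text \<open>Some path of \<open>P\<close> passes directly between the fibre of \<open>d\<close> and
  its complement.\<close>

definition crossed :: "nat list set \<Rightarrow> nat \<Rightarrow> bool" where
  "crossed P d \<longleftrightarrow> (\<exists>x y. adjacent_in P x y \<and> d dvd x \<and> \<not> d dvd y)"

lemma uncrossed_path: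
  assumes "\<not> crossed P d" "p \<in> P" "x \<in> set p" "y \<in> set p" "d dvd x"
  shows "d dvd y"
proof -
  \<comment> \<open>Induction over the suffixes \<open>q\<close> of \<open>p\<close>; the prefix
    \<open>us\<close> is carried along so that neighbours in \<open>q\<close> are recognised as
    adjacent in \<open>P\<close>.\<close>
  have "successively (\<lambda>x y. d dvd x \<longleftrightarrow> d dvd y) q" if "p = us @ q" for us q
    using that
  proof (induction q arbitrary: us)
    case (Cons a q)
    have IH: "successively (\<lambda>x y. d dvd x \<longleftrightarrow> d dvd y) q" using Cons.IH[of "us @ [a]"] Cons.prems by simp
    show ?case
    proof (cases q)
      case (Cons b q')
      then have "adjacent_in P a b" "adjacent_in P b a"
        using assms(2) Cons.prems unfolding adjacent_in_def by blast+
      then show ?thesis using IH assms(1) Cons unfolding crossed_def by (auto simp: successively_Cons)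
    qed simp
  qed simp
  from this[of "[]" p] have s: "successively (\<lambda>x y. d dvd x \<longleftrightarrow> d dvd y) p" by simp
  have "d dvd x \<longleftrightarrow> d dvd hd q" if "successively (\<lambda>x y. d dvd x \<longleftrightarrow> d dvd y) q" "x \<in> set q" for x q
    using that by (induction q) (auto simp: successively_Cons)
  from this[OF s assms(3)] this[OF s assms(4)] show ?thesis using assms(5) by blast
qed

text \<open>If a path joins a multiple \<open>x\<close> of \<open>p\<close> to a non-multiple
  \<open>y\<close>, then \<open>y\<close> divides \<open>x\<close>, hence \<open>x / p\<close>, so
  \<open>y\<close> is at most \<open>B\<close>. Each such \<open>y\<close> has at most two
  neighbours, and each neighbour is a multiple of at most one prime in \<open>A\<close>, as two of
  them have a product above \<open>N\<close>.\<close>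

lemma card_crossed_le:
  assumes P: "paths_on {1..N} P" and A: "finite A" "\<And>p. p \<in> A \<Longrightarrow> prime p"
    "\<And>p. p \<in> A \<Longrightarrow> N div p \<le> B" "\<And>p q. p \<in> A \<Longrightarrow> q \<in> A \<Longrightarrow> p \<noteq> q \<Longrightarrow> N < p * q"
  shows "card {p \<in> A. crossed P p} \<le> 2 * B"
proof -
  let ?nb = "\<lambda>e. {x. adjacent_in P e x}"
  have *: "card {p \<in> A. p dvd x} \<le> 1" if "x \<in> {1..N}" for x
  proof -
    have "p = q" if "p \<in> A" "q \<in> A" "p dvd x" "q dvd x" for p q
    proof (rule ccontr)
      assume "p \<noteq> q"
      then have "p * q dvd x" using that A(2) primes_coprime divides_mult by blast
      then have "p * q \<le> x" using \<open>x \<in> _\<close> by (intro dvd_imp_le) auto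
      then show False using A(4)[OF that(1,2) \<open>p \<noteq> q\<close>] \<open>x \<in> _\<close> by auto
    qed
    then show ?thesis using A(1) by (simp add: card_le_Suc0_iff_eq)
  qed
  have "{p \<in> A. crossed P p} \<subseteq> (\<Union>e\<in>{1..B}. \<Union>x\<in>?nb e. {p \<in> A. p dvd x})"
  proof
    fix p assume "p \<in> {p \<in> A. crossed P p}"
    then obtain x y where p: "p \<in> A" and xy: "adjacent_in P x y" "p dvd x" "\<not> p dvd y"
      unfolding crossed_def by blast
    note adj = adjacent_inD[OF P xy(1)]
    from xy(2) obtain m where m: "x = p * m" by blast
    have "y dvd x"
      using adj(1) xy(2,3) unfolding divisor_edge_def using dvd_trans by blast
    moreover have "coprime y p" using xy(3) A(2)[OF p] by (simp add: coprime_commute prime_imp_coprime)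
    ultimately have "y dvd m" using m by (simp add: coprime_dvd_mult_right_iff)
    have "m > 0" using adj(2) m by (auto intro: Nat.gr0I)
    have "m \<le> N div p" using adj(2) m A(2)[OF p] by (simp add: less_eq_div_iff_mult_less_eq prime_gt_0_nat mult.commute)
    then have "y \<le> B"
      using dvd_imp_le[OF \<open>y dvd m\<close> \<open>m > 0\<close>] A(3)[OF p] by linarith
    moreover have "adjacent_in P y x" using xy(1) adjacent_in_sym by blast
    ultimately show "p \<in> (\<Union>e\<in>{1..B}. \<Union>x\<in>?nb e. {p \<in> A. p dvd x})"
      using p xy(2) adj(3) by auto
  qed
  then have "card {p \<in> A. crossed P p} \<le> card (\<Union>e\<in>{1..B}. \<Union>x\<in>?nb e. {p \<in> A. p dvd x})"
    using A(1) card_adjacent_le(1)[OF P] by (intro card_mono) auto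
  also have "\<dots> \<le> (\<Sum>e\<in>{1..B}. card (\<Union>x\<in>?nb e. {p \<in> A. p dvd x}))"
    by (rule card_UN_le) simp
  also have "\<dots> \<le> (\<Sum>e\<in>{1..B}. 2)"
  proof (rule sum_mono)
    fix e
    have "card (\<Union>x\<in>?nb e. {p \<in> A. p dvd x}) \<le> (\<Sum>x\<in>?nb e. card {p \<in> A. p dvd x})"
      using card_adjacent_le(1)[OF P] by (intro card_UN_le) simp
    also have "\<dots> \<le> (\<Sum>x\<in>?nb e. 1)" using adjacent_inD(3)[OF P] by (intro sum_mono *) auto
    also have "\<dots> \<le> 2" using card_adjacent_le(2)[OF P] by simp
    finally show "card (\<Union>x\<in>?nb e. {p \<in> A. p dvd x}) \<le> 2" .
  qed
  finally show ?thesis by simp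
qed

text \<open>The fibre of \<open>d\<close> is a copy of the divisor graph on at most \<open>{1..5}\<close>. There \<open>2\<close> has no
  neighbours besides \<open>1\<close> and \<open>4\<close>, and \<open>4\<close> none besides \<open>1\<close> and \<open>2\<close>, so that one of \<open>2\<close> and \<open>4\<close> is
  an end of its path. This fails for \<open>{1..6}\<close>, because of the path 5, 1, 4, 2, 6, 3.\<close>

lemma fibre_path_even_end:
  assumes Q: "paths_on {1..y} Q" and d: "d > 0" "2 * d \<le> y" "y < 6 * d" "\<not> crossed Q d"
  obtains W W' where "W \<in> Q" "divisor_path W'" "set W' = set W" "even (hd W')"
    "\<And>x. x \<in> set W \<Longrightarrow> d dvd x"
proof -
  have "2 * d \<in> {1..y}" using d by auto
  then obtain W where W: "W \<in> Q" "2 * d \<in> set W" using paths_on_ex[OF Q] by blast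
  have path: "divisor_path W" by (rule paths_on_path[OF Q W(1)])
  have dvd: "d dvd x" if "x \<in> set W" for x
    using uncrossed_path[OF d(4) W(1) W(2) that] by simp
  have form: "\<exists>k\<in>{1,2,3,4,5}. x = d * k" if x: "x \<in> set W" for x
  proof -
    obtain k where k: "x = d * k" using dvd[OF x] by blast
    have "x \<in> {1..y}" using x paths_on_subset[OF Q W(1)] by blast
    then have "d * k \<le> y" "k > 0" using k by (auto intro!: Nat.gr0I)
    moreover have "k < 6"
    proof (rule ccontr)
      assume "\<not> k < 6"
      then have "d * 6 \<le> d * k" by (intro mult_le_mono2) simp
      then show False using \<open>d * k \<le> y\<close> d(3) by linarith
    qed
    ultimately have "k \<in> {1,2,3,4,5}" by auto
    then show ?thesis using k by blast
  qed
  have nb2: "x \<in> {d, 4 * d}" if x: "x \<in> set W" "divisor_edge x (2 * d)" for x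
  proof -
    obtain k where k: "k \<in> {1,2,3,4,5}" "x = d * k" using form[OF x(1)] by blast
    then have "divisor_edge k 2" using divisor_edge_mult[OF d(1), of k 2] x(2) by (simp add: mult.commute)
    then show ?thesis using k by (auto simp: divisor_edge_def)
  qed
  have nb4: "x \<in> {d, 2 * d}" if x: "x \<in> set W" "divisor_edge x (4 * d)" for x
  proof -
    obtain k where k: "k \<in> {1,2,3,4,5}" "x = d * k" using form[OF x(1)] by blast
    then have "divisor_edge k 4" using divisor_edge_mult[OF d(1), of k 4] x(2) by (simp add: mult.commute)
    then show ?thesis using k by (auto simp: divisor_edge_def)
  qed
  \<comment> \<open>After \<open>d\<close>, \<open>2 * d\<close>, \<open>4 * d\<close> nothing can
    follow, because the only possible neighbours \<open>d\<close> and \<open>2 * d\<close> of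
    \<open>4 * d\<close> have been visited already.\<close>
  have last4: "even (last V)" if "V = us @ d # 2 * d # 4 * d # vs" "set V = set W" "divisor_path V" for V us vs
  proof (cases vs)
    case Nil
    then show ?thesis using that by simp
  next
    case (Cons c vs')
    have "divisor_edge (4 * d) c"
      using that(1,3) unfolding Cons by (auto simp: divisor_path_conv successively_append_iff)
    then have "divisor_edge c (4 * d)" by (subst divisor_edge_sym)
    moreover have "c \<in> set W" using that(1) unfolding that(2)[symmetric] Cons by simp
    ultimately have "c \<in> {d, 2 * d}" by (intro nb4)
    then show ?thesis using that unfolding Cons by (auto simp: divisor_path_conv)
  qed
  have "even (hd W) \<or> even (last W)"
  proof -
    obtain us vs where W': "W = us @ 2 * d # vs" using split_list[OF W(2)] by blast
    show ?thesis
    proof (cases "us = [] \<or> vs = []")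
      case True
      then show ?thesis using W' by auto
    next
      case False
      obtain us' a where us: "us = us' @ [a]" using False by (metis rev_exhaust)
      obtain vs' b where vs: "vs = b # vs'" using False by (metis list.exhaust)
      have "divisor_edge a (2 * d)" "divisor_edge (2 * d) b" "a \<noteq> b"
        using path unfolding W' us vs by (auto simp: divisor_path_conv successively_append_iff)
      moreover from this(2) have "divisor_edge b (2 * d)" by (subst divisor_edge_sym)
      moreover have "a \<in> set W" "b \<in> set W" by (auto simp: W' us vs)
      ultimately consider "a = d" "b = 4 * d" | "a = 4 * d" "b = d"
        using nb2[of a] nb2[of b] by auto
      then show ?thesis
      proof cases
        case 1
        then show ?thesis using last4[of W us' vs'] path by (simp add: W' us vs)
      next
        case 2
        \<comment> \<open>Read backwards, the path meets \<open>d\<close>, \<open>2 * d\<close>,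
          \<open>4 * d\<close> in the order of the first case.\<close>
        have "divisor_path (rev W)" using path by (simp only: divisor_path_rev)
        then have "even (last (rev W))"
          using 2 by (intro last4[of _ "rev vs'" "rev us'"]) (simp_all add: W' us vs, auto)
        then show ?thesis by (simp add: last_rev)
      qed
    qed
  qed
  then show ?thesis
  proof
    assume "even (hd W)"
    then show ?thesis using that[of W W] W(1) path dvd by blast
  next
    assume "even (last W)"
    then show ?thesis using that[of W "rev W"] W(1) path dvd by (auto simp: divisor_path_rev hd_rev)
  qed
qed

text \<open>Surgery with an empty \<open>T\<close> and a single path just exchanges that path for
  its reversal, which brings the even end to the front.\<close>

lemma exists_even_fibre_path:
  assumes Q: "paths_on {1..y} Q" and d: "d > 0" "2 * d \<le> y" "y < 6 * d" "\<not> crossed Q d"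
  shows "\<exists>Q' R. paths_on {1..y} Q' \<and> card Q' \<le> card Q \<and> R \<in> Q' \<and> even (hd R) \<and>
    (\<forall>x\<in>set R. d dvd x)"
proof -
  obtain W W' where W: "W \<in> Q" "divisor_path W'" "set W' = set W" "even (hd W')"
    "\<And>x. x \<in> set W \<Longrightarrow> d dvd x"
    using fibre_path_even_end[OF Q d] by metis
  have "\<exists>P'. paths_on {1..y} P' \<and> card P' \<le> card Q \<and> W' \<in> P'"
    by (rule paths_on_surgery[OF Q, of "{}" "{W}"]) (use W in auto)
  then show ?thesis using W by auto
qed

text \<open>The numbers \<open>1\<close> and \<open>2\<close> are cut out of their paths and reused to attach the two ends of
  \<open>C\<close> to the fibres of \<open>d'\<close> and \<open>d\<close>; both operations balance.\<close>

lemma exists_linked_path: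
  assumes Q: "paths_on {1..y} Q" and C: "C \<in> Q" "even (hd C)" "1 \<notin> set C" "2 \<notin> set C"
    and d: "d > 2" "2 * d \<le> y" "y < 6 * d" "\<not> crossed Q d" "\<not> d dvd hd C"
    and d': "d' > 2" "d' \<le> y" "\<not> crossed Q d'" "\<not> d' dvd hd C"
    and dd': "prime d" "prime d'" "d \<noteq> d'" "y < d * d'"
  shows "\<exists>Q' R. paths_on {1..y} Q' \<and> card Q' \<le> card Q \<and> R \<in> Q' \<and> d dvd hd R \<and> d' dvd last R \<and>
    length C \<le> length R"
proof -
  have d0: "d > 0" using d by simp
  obtain W W' where W: "W \<in> Q" "divisor_path W'" "set W' = set W" "even (hd W')"
    "\<And>x. x \<in> set W \<Longrightarrow> d dvd x"
    using fibre_path_even_end[OF Q d0 d(2,3,4)] by metis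
  have "d' \<in> {1..y}" using d' by auto
  then obtain V where V: "V \<in> Q" "d' \<in> set V" using paths_on_ex[OF Q] by blast
  have V_dvd: "d' dvd x" if "x \<in> set V" for x
    using uncrossed_path[OF d'(3) V(1) V(2) that] by simp
  have ne: "W' \<noteq> []" "C \<noteq> []" "V \<noteq> []"
    using W(2) paths_on_path[OF Q C(1)] paths_on_path[OF Q V(1)] by (auto simp: divisor_path_conv)
  have pos: "x > 0" if "x \<in> set p" "p \<in> Q" for x p
    using that paths_on_subset[OF Q that(2)] by fastforce
  have WC: "set W \<inter> set C = {}"
    using paths_on_disjoint[OF Q W(1) C(1)] W(5)[of "hd C"] d(5) ne by (metis disjoint_iff hd_in_set)
  have VC: "set V \<inter> set C = {}"
    using paths_on_disjoint[OF Q V(1) C(1)] V_dvd[of "hd C"] d'(4) ne by (metis disjoint_iff hd_in_set)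
  have WV: "set W \<inter> set V = {}"
  proof -
    have False if "x \<in> set W" "x \<in> set V" for x
    proof -
      have "d * d' dvd x"
        using W(5)[OF that(1)] V_dvd[OF that(2)] dd' primes_coprime divides_mult by blast
      then have "d * d' \<le> x" using pos[OF that(1) W(1)] by (rule dvd_imp_le)
      moreover have "x \<le> y" using paths_on_subset[OF Q W(1)] that(1) by auto
      ultimately show False using dd'(4) by simp
    qed
    then show ?thesis by blast
  qed
  have small: "1 \<notin> set W" "2 \<notin> set W" "1 \<notin> set V" "2 \<notin> set V"
  proof -
    have "\<not> k dvd 1" "\<not> k dvd 2" if "k > 2" for k :: nat
      using that by (auto dest!: dvd_imp_le)
    then show "1 \<notin> set W" "2 \<notin> set W" "1 \<notin> set V" "2 \<notin> set V"
      using W(5) V_dvd d(1) d'(1) by blast+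
  qed
  have hdC: "hd C > 2" "hd V > 1" "last C > 1" "hd W' > 2"
  proof -
    have *: "x > 2" if "x \<in> set p" "p \<in> Q" "1 \<notin> set p" "2 \<notin> set p" for x p
      using pos[OF that(1,2)] that by (cases "x = 1 \<or> x = 2") auto
    show "hd C > 2" using *[of "hd C" C] C ne by simp
    show "hd V > 1" using *[of "hd V" V] V small ne by simp
    show "last C > 1" using *[of "last C" C] C ne by simp
    show "hd W' > 2" using *[of "hd W'" W] W(1) small ne W(3) hd_in_set[of W'] by simp
  qed
  \<comment> \<open>Both neighbours \<open>hd W'\<close> and \<open>hd C\<close> of \<open>2\<close>
    are even and exceed it; \<open>1\<close> divides everything, so no parity is required of
    \<open>last C\<close> and \<open>hd V\<close>.\<close>
  let ?X = "rev W' @ [2] @ C @ [1] @ V"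
  have single: "divisor_path [2]" "divisor_path [1]" by (auto simp: divisor_path_conv)
  have "divisor_path ([1] @ V)"
    using V ne hdC small single paths_on_path[OF Q V(1)]
    by (subst divisor_path_append_iff) (auto simp: divisor_edge_def)
  then have "divisor_path (C @ [1] @ V)"
    using ne hdC C VC paths_on_path[OF Q C(1)]
    by (subst divisor_path_append_iff) (auto simp: divisor_edge_def)
  then have "divisor_path ([2] @ C @ [1] @ V)"
    using ne hdC C small single
    by (subst divisor_path_append_iff) (auto simp: divisor_edge_def)
  then have "divisor_path ?X"
    using ne hdC C small single W WC WV
    by (subst divisor_path_append_iff) (auto simp: divisor_edge_def last_rev divisor_path_rev)
  moreover have "W \<noteq> C" "W \<noteq> V" "C \<noteq> V" using WC VC WV ne W(3) by auto
  moreover have "y \<ge> 2" using d by simp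
  ultimately have "\<exists>P'. paths_on {1..y} P' \<and> card P' \<le> card Q \<and> ?X \<in> P'"
    using C W(1,3) V(1) small by (intro paths_on_surgery[OF Q, of "{1,2}" "{W,C,V}"]) auto
  then obtain P' where P': "paths_on {1..y} P'" "card P' \<le> card Q" "?X \<in> P'" by blast
  moreover have "d dvd hd ?X" using W(3,5) ne by (simp add: hd_append hd_rev) (metis last_in_set)
  moreover have "d' dvd last ?X" using V_dvd ne by simp
  moreover have "length C \<le> length ?X" by simp
  ultimately show ?thesis by blast
qed

section \<open>Exchanging partitions between a fibre and a shorter interval\<close>

lemma F_le: "paths_on {1..N} P \<Longrightarrow> F (real N) \<le> card P"
  unfolding F_def by (rule Least_le) (auto simp: path_partition_conv)

lemma multiples_upto:
  assumes "p > (0::nat)"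
  shows "{n \<in> {1..N}. p dvd n} = (*) p ` {1..N div p}"
proof (intro equalityI subsetI)
  fix n assume "n \<in> {n \<in> {1..N}. p dvd n}"
  then obtain m where m: "n = p * m" "n \<in> {1..N}" by auto
  then have "m \<in> {1..N div p}"
    using assms by (auto simp: less_eq_div_iff_mult_less_eq mult.commute Suc_le_eq intro!: Nat.gr0I)
  then show "n \<in> (*) p ` {1..N div p}" using m by blast
next
  fix n assume "n \<in> (*) p ` {1..N div p}"
  then show "n \<in> {n \<in> {1..N}. p dvd n}"
    using assms by (auto simp: less_eq_div_iff_mult_less_eq mult.commute Suc_le_eq)
qed

text \<open>Division by \<open>p\<close> carries the partition of the fibre to one of
  \<open>{1..y}\<close>. So an uncrossed fibre always holds at least \<open>F y\<close> paths and
  can be repartitioned optimally without loss.\<close>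

lemma F_le_card_fibre:
  assumes P: "paths_on ((*) p ` {1..y}) P" and p: "p > 0"
  shows "F (real y) \<le> card P"
proof -
  let ?P' = "map (\<lambda>n. n div p) ` P"
  have eq: "map ((*) p) (map (\<lambda>n. n div p) q) = q" if "q \<in> P" for q
    using paths_on_subset[OF P that] p by (auto intro!: map_idI)
  have "paths_on {1..y} ?P'"
    unfolding paths_on_def
  proof (intro conjI)
    show "\<forall>q\<in>?P'. divisor_path q"
      using eq paths_on_path[OF P] divisor_path_map_mult[OF p] by (metis imageE)
    have "(\<Union>q\<in>?P'. set q) = (\<lambda>n. n div p) ` (\<Union>q\<in>P. set q)" by auto
    also have "(\<Union>q\<in>P. set q) = (*) p ` {1..y}" using P by (simp add: paths_on_def)
    also have "(\<lambda>n. n div p) ` (*) p ` {1..y} = {1..y}" using p by (simp add: image_image)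
    finally show "(\<Union>q\<in>?P'. set q) = {1..y}" .
    show "disjoint_family_on set ?P'"
      unfolding disjoint_family_on_def
    proof (intro ballI impI)
      fix a b assume ab: "a \<in> ?P'" "b \<in> ?P'" "a \<noteq> b"
      then obtain q r where qr: "q \<in> P" "r \<in> P" "a = map (\<lambda>n. n div p) q" "b = map (\<lambda>n. n div p) r"
        by blast
      have "set q \<inter> set r = {}" using paths_on_disjoint[OF P qr(1,2)] ab(3) qr by blast
      moreover have "set q = (*) p ` set a" "set r = (*) p ` set b"
        using eq[OF qr(1)] eq[OF qr(2)] qr(3,4) by (metis set_map)+
      ultimately show "set a \<inter> set b = {}" by blast
    qed
  qed
  then have "F (real y) \<le> card ?P'" by (rule F_le)
  also have "\<dots> \<le> card P" using paths_on_finite[OF P] by (intro card_image_le) simp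
  finally show ?thesis .
qed

text \<open>A path meeting an uncrossed fibre stays inside it, so each fibre is partitioned by paths
  of \<open>P\<close>, at least \<open>F (N div p i)\<close> of them. The fibres are disjoint
  because \<open>p i * p j\<close> exceeds \<open>N\<close>, hence all can be exchanged at
  once.\<close>

lemma replace_fibres:
  assumes P: "paths_on {1..N} P" and I: "finite I"
    and p: "\<And>i. i \<in> I \<Longrightarrow> prime (p i)" "\<And>i. i \<in> I \<Longrightarrow> \<not> crossed P (p i)"
      "\<And>i j. i \<in> I \<Longrightarrow> j \<in> I \<Longrightarrow> i \<noteq> j \<Longrightarrow> p i \<noteq> p j \<and> N < p i * p j"
    and Q: "\<And>i. i \<in> I \<Longrightarrow> paths_on {1..N div p i} (Q i)"
      "\<And>i. i \<in> I \<Longrightarrow> card (Q i) \<le> F (real (N div p i))"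
  shows "\<exists>P'. paths_on {1..N} P' \<and> card P' \<le> card P \<and> (\<forall>i\<in>I. map ((*) (p i)) ` Q i \<subseteq> P')"
proof -
  let ?M = "\<lambda>i. {n \<in> {1..N}. p i dvd n}"
  let ?P = "\<lambda>i. {q \<in> P. set q \<subseteq> ?M i}"
  let ?Q = "\<lambda>i. map ((*) (p i)) ` Q i"
  let ?P' = "(P - (\<Union>i\<in>I. ?P i)) \<union> (\<Union>i\<in>I. ?Q i)"
  have finP: "finite P" using paths_on_finite[OF P] by simp
  have p0: "p i > 0" if "i \<in> I" for i using p(1)[OF that] by (rule prime_gt_0_nat)
  have UP: "\<Union>(set ` ?P i) = ?M i" if "i \<in> I" for i
  proof (intro equalityI subsetI)
    fix n assume n: "n \<in> ?M i"
    then obtain q where q: "q \<in> P" "n \<in> set q" using paths_on_ex[OF P] by blast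
    have "set q \<subseteq> ?M i"
      using uncrossed_path[OF p(2)[OF that] q] n paths_on_subset[OF P q(1)] by blast
    then show "n \<in> \<Union>(set ` ?P i)" using q by blast
  qed auto
  have Mdisj: "disjoint_family_on ?M I"
    unfolding disjoint_family_on_def
  proof (intro ballI impI)
    fix i j assume ij: "i \<in> I" "j \<in> I" "i \<noteq> j"
    have False if n: "n \<in> ?M i" "n \<in> ?M j" for n
    proof -
      have "p i * p j dvd n"
        using n p(1)[OF ij(1)] p(1)[OF ij(2)] p(3)[OF ij] primes_coprime divides_mult by blast
      then have "p i * p j \<le> n" using n by (intro dvd_imp_le) auto
      then show False using n p(3)[OF ij] by auto
    qed
    then show "?M i \<inter> ?M j = {}" by blast
  qed
  have Pi: "paths_on (?M i) (?P i)" if "i \<in> I" for i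
    using paths_on_sub[OF P, of "?P i"] UP[OF that] by auto
  have Qi: "paths_on (?M i) (?Q i)" if "i \<in> I" for i
    using paths_on_map_mult[OF Q(1)[OF that] p0[OF that]] multiples_upto[OF p0[OF that]] by simp
  have "paths_on ({1..N} - \<Union>(set ` (\<Union>i\<in>I. ?P i))) (P - (\<Union>i\<in>I. ?P i))"
    by (rule paths_on_Diff[OF P]) blast
  moreover have "\<Union>(set ` (\<Union>i\<in>I. ?P i)) = (\<Union>i\<in>I. ?M i)"
  proof -
    have "\<Union>(set ` (\<Union>i\<in>I. A i)) = (\<Union>i\<in>I. \<Union>(set ` A i))" for A :: "_ \<Rightarrow> nat list set"
      by blast
    then have "\<Union>(set ` (\<Union>i\<in>I. ?P i)) = (\<Union>i\<in>I. \<Union>(set ` ?P i))" .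
    also have "\<dots> = (\<Union>i\<in>I. ?M i)" by (intro SUP_cong refl UP)
    finally show ?thesis .
  qed
  ultimately have "paths_on ({1..N} - (\<Union>i\<in>I. ?M i)) (P - (\<Union>i\<in>I. ?P i))" by simp
  then have "paths_on (({1..N} - (\<Union>i\<in>I. ?M i)) \<union> (\<Union>i\<in>I. ?M i)) ?P'"
    by (rule paths_on_Un[OF _ paths_on_UN[OF Qi Mdisj]]) (assumption, blast)
  moreover have "({1..N} - (\<Union>i\<in>I. ?M i)) \<union> (\<Union>i\<in>I. ?M i) = {1..N}" by auto
  ultimately have "paths_on {1..N} ?P'" by simp
  moreover have "card ?P' \<le> card P"
  proof -
    have disj: "?P i \<inter> ?P j = {}" if "i \<in> I" "j \<in> I" "i \<noteq> j" for i j
    proof -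
      have "?M i \<inter> ?M j = {}" using Mdisj that unfolding disjoint_family_on_def by simp
      then have "set q = {}" if "q \<in> ?P i" "q \<in> ?P j" for q
 
      proof -
        have "set q \<subseteq> ?M i" "set q \<subseteq> ?M j" using that by simp_all
        then show ?thesis using \<open>?M i \<inter> ?M j = {}\<close> by (metis Int_greatest subset_empty)
      qed
      \<comment> \<open>Without this, an empty path could belong to \<open>?P i\<close> and
        \<open>?P j\<close> at the same time.\<close>
      moreover have "set q \<noteq> {}" if "q \<in> P" for q
        using paths_on_path[OF P that] by (simp add: divisor_path_conv)
      ultimately show ?thesis by blast
    qed
    have "card (\<Union>i\<in>I. ?Q i) \<le> (\<Sum>i\<in>I. card (?Q i))" by (rule card_UN_le[OF I])
    also have "\<dots> \<le> (\<Sum>i\<in>I. card (?P i))"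
    proof (rule sum_mono)
      fix i assume i: "i \<in> I"
      have "finite (Q i)" using paths_on_finite[OF Q(1)[OF i]] by simp
      then have "card (?Q i) \<le> card (Q i)" by (rule card_image_le)
      also have "\<dots> \<le> F (real (N div p i))" by (rule Q(2)[OF i])
      also have "\<dots> \<le> card (?P i)"
        using F_le_card_fibre[OF _ p0[OF i]] Pi[OF i] multiples_upto[OF p0[OF i]] by simp
      finally show "card (?Q i) \<le> card (?P i)" .
    qed
    also have "\<dots> = card (\<Union>i\<in>I. ?P i)"
      using I finP disj by (intro card_UN_disjoint[symmetric]) auto
    finally have le: "card (\<Union>i\<in>I. ?Q i) \<le> card (\<Union>i\<in>I. ?P i)" .
    have "card (P - (\<Union>i\<in>I. ?P i)) = card P - card (\<Union>i\<in>I. ?P i)"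
      using finP by (intro card_Diff_subset) (auto intro: finite_subset)
    moreover have "card (\<Union>i\<in>I. ?P i) \<le> card P" using finP by (intro card_mono) auto
    ultimately show ?thesis
      using le card_Un_le[of "P - (\<Union>i\<in>I. ?P i)" "\<Union>i\<in>I. ?Q i"] by linarith
  qed
  ultimately show ?thesis by blast
qed

text \<open>The path is \<open>r 0, d 0, r 1, d 1, ..., d (n - 1), r n\<close>: one more path than
  connectors, the balance that \<open>paths_on_surgery\<close> asks for.\<close>

lemma exists_chain:
  assumes "\<And>i. i \<le> n \<Longrightarrow> divisor_path (r i)"
    and "\<And>i j. i \<le> n \<Longrightarrow> j \<le> n \<Longrightarrow> i \<noteq> j \<Longrightarrow> set (r i) \<inter> set (r j) = {}"
    and "inj_on d {..<n}" "\<And>i. i < n \<Longrightarrow> d i > (0::nat)"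
    and "\<And>i j. i < n \<Longrightarrow> j \<le> n \<Longrightarrow> d i \<notin> set (r j)"
    and "\<And>i. i < n \<Longrightarrow> divisor_edge (last (r i)) (d i)"
    and "\<And>i. i < n \<Longrightarrow> divisor_edge (d i) (hd (r (Suc i)))"
  shows "\<exists>X. divisor_path X \<and> set X = d ` {..<n} \<union> (\<Union>i\<le>n. set (r i)) \<and> hd X = hd (r 0) \<and>
    last X = last (r n) \<and> (\<Sum>i\<le>n. length (r i)) \<le> length X"
  using assms
proof (induction n)
  case 0
  then show ?case by (intro exI[of _ "r 0"]) auto
next
  case (Suc n)
  have "\<exists>X. divisor_path X \<and> set X = d ` {..<n} \<union> (\<Union>i\<le>n. set (r i)) \<and> hd X = hd (r 0) \<and>
    last X = last (r n) \<and> (\<Sum>i\<le>n. length (r i)) \<le> length X"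
    using Suc.prems by (intro Suc.IH) (auto simp: inj_on_def)
  then obtain X where X: "divisor_path X" "set X = d ` {..<n} \<union> (\<Union>i\<le>n. set (r i))"
    "hd X = hd (r 0)" "last X = last (r n)" "(\<Sum>i\<le>n. length (r i)) \<le> length X" by blast
  have ne: "X \<noteq> []" "r (Suc n) \<noteq> []"
    using X(1) Suc.prems(1)[of "Suc n"] by (auto simp: divisor_path_conv)
  have dn: "d n \<notin> set X" "d n \<notin> set (r (Suc n))"
  proof -
    have "d n \<noteq> d i" if "i < n" for i
      using inj_onD[OF Suc.prems(3), of n i] that by auto
    then show "d n \<notin> set X" using Suc.prems(5)[of n] unfolding X(2) by fastforce
    show "d n \<notin> set (r (Suc n))" using Suc.prems(5)[of n "Suc n"] by simp
  qed
  have disj: "set X \<inter> set (r (Suc n)) = {}"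
  proof -
    have "d i \<notin> set (r (Suc n))" if "i < n" for i using Suc.prems(5)[of i "Suc n"] that by simp
    moreover have "set (r i) \<inter> set (r (Suc n)) = {}" if "i \<le> n" for i
      using Suc.prems(2)[of i "Suc n"] that by simp
    ultimately show ?thesis unfolding X(2) by blast
  qed
  have "divisor_path ([d n] @ r (Suc n))"
    using Suc.prems(1)[of "Suc n"] Suc.prems(4)[of n] Suc.prems(7)[of n] ne dn
    by (subst divisor_path_append_iff) (auto simp: divisor_path_conv)
  then have "divisor_path (X @ [d n] @ r (Suc n))"
    using X(1,4) Suc.prems(6)[of n] ne dn disj by (subst divisor_path_append_iff) auto
  moreover have "set (X @ [d n] @ r (Suc n)) = d ` {..<Suc n} \<union> (\<Union>i\<le>Suc n. set (r i))"
    using X(2) by (auto simp: lessThan_Suc atMost_Suc)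
  ultimately show ?case
    using X ne by (intro exI[of _ "X @ [d n] @ r (Suc n)"]) auto
qed

text \<open>Greedy choice: at each index at most \<open>2 * c\<close> elements are forbidden by the
  two sets \<open>b\<close>, and fewer than \<open>n\<close> are taken already.\<close>

lemma exists_injective_choice:
  fixes D :: "'a set"
  assumes "finite D" "\<And>i. b i \<subseteq> D" "\<And>i. card (b i) \<le> c" "n + 2 * c \<le> card D"
  shows "\<exists>d::nat \<Rightarrow> 'a. inj_on d {..<n} \<and> (\<forall>i<n. d i \<in> D - b i - b (Suc i))"
  using assms(4)
proof (induction n)
  case (Suc n)
  then obtain d where d: "inj_on d {..<n}" "\<forall>i<n. d i \<in> D - b i - b (Suc i)" by auto
  have fin: "finite (b i)" for i using assms(1,2) finite_subset by blast
  have "card (b n \<union> b (Suc n) \<union> d ` {..<n}) \<le> card (b n) + card (b (Suc n)) + card (d ` {..<n})"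
    by (meson add_le_mono card_Un_le le_refl order.trans)
  also have "\<dots> \<le> c + c + n"
    using assms(3)[of n] assms(3)[of "Suc n"] card_image_le[of "{..<n}" d] by simp
  also have "\<dots> < card D" using Suc.prems by simp
  finally have "\<not> D \<subseteq> b n \<union> b (Suc n) \<union> d ` {..<n}"
    using fin by (meson card_mono finite_UnI finite_imageI finite_lessThan leD)
  then obtain x where x: "x \<in> D" "x \<notin> b n" "x \<notin> b (Suc n)" "x \<notin> d ` {..<n}" by blast
  have "inj_on (d(n := x)) {..<Suc n}"
    using d(1) x(4) by (auto simp: inj_on_def lessThan_Suc)
  moreover have "\<forall>i<Suc n. (d(n := x)) i \<in> D - b i - b (Suc i)"
    using d(2) x by (auto simp: less_Suc_eq)
  ultimately show ?case by blast
qed simp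

section \<open>The recursion\<close>

text \<open>Excluding \<open>1\<close> and \<open>2\<close> from the path keeps them available for prolonging it.\<close>

definition admits_even_path :: "nat \<Rightarrow> real \<Rightarrow> bool" where
  "admits_even_path N l \<longleftrightarrow> (\<exists>P q. paths_on {1..N} P \<and> card P \<le> F (real N) \<and> q \<in> P \<and>
     even (hd q) \<and> 1 \<notin> set q \<and> 2 \<notin> set q \<and> l \<le> real (length q))"

lemma optimal_partition_conv:
  "optimal_partition N P \<longleftrightarrow> paths_on {1..N} P \<and> card P \<le> F (real N)"
  using F_le[of N P] by (auto simp: optimal_partition_def path_partition_conv)

lemma length_le_L:
  assumes "optimal_partition N P" "q \<in> P"
  shows "length q \<le> L N"
  unfolding L_def using assms optimal_lengths_finite
  by (intro Max_ge) (auto simp: optimal_lengths_def)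

lemma L_ge:
  assumes "admits_even_path N l"
  shows "l \<le> real (L N)"
proof -
  obtain P q where "optimal_partition N P" "q \<in> P" "l \<le> real (length q)"
    using assms by (auto simp: admits_even_path_def optimal_partition_conv)
  with length_le_L[of N P q] show ?thesis by linarith
qed

lemma L_ge_1:
  assumes "N \<ge> 1"
  shows "L N \<ge> 1"
proof -
  obtain P where P: "optimal_partition N P" using optimal_partition_exists by blast
  then have pp: "paths_on {1..N} P" by (simp add: optimal_partition_conv)
  obtain q where q: "q \<in> P" using paths_on_ex[OF pp, of 1] assms by auto
  have "length q \<ge> 1" using paths_on_path[OF pp q] by (auto simp: divisor_path_conv Suc_le_eq)
  then show ?thesis using length_le_L[OF P q] by simp
qed

text \<open>Since \<open>N < 6 * d\<close>, at most \<open>2 * 5\<close> primes of \<open>D\<close>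
  are crossed, so one of eleven is not. A path of multiples of \<open>d > 2\<close> avoids
  \<open>1\<close> and \<open>2\<close>.\<close>

lemma admits_even_path_base:
  assumes D: "finite D" "11 \<le> card D"
    "\<And>d. d \<in> D \<Longrightarrow> prime d \<and> 2 < d \<and> 2 * d \<le> N \<and> N < 6 * d"
    "\<And>d d'. d \<in> D \<Longrightarrow> d' \<in> D \<Longrightarrow> d \<noteq> d' \<Longrightarrow> N < d * d'"
  shows "admits_even_path N 1"
proof -
  obtain P where P: "paths_on {1..N} P" "card P \<le> F (real N)"
    using optimal_partition_exists by (auto simp: optimal_partition_conv)
  have "card {d \<in> D. crossed P d} \<le> 2 * 5"
    using D by (intro card_crossed_le[OF P(1)])
      (auto simp: less_Suc_eq_le[symmetric] less_mult_imp_div_less)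
  then have "card {d \<in> D. crossed P d} < card D" using D(2) by simp
  then have "{d \<in> D. crossed P d} \<noteq> D" by auto
  then obtain d where d: "d \<in> D" "\<not> crossed P d" by blast
  note Dd = D(3)[OF d(1)]
  obtain Q' R where R: "paths_on {1..N} Q'" "card Q' \<le> card P" "R \<in> Q'" "even (hd R)"
    "\<forall>x\<in>set R. d dvd x"
    using exists_even_fibre_path[OF P(1), of d] d(2) Dd by auto
  have "\<not> d dvd 1" "\<not> d dvd 2" using Dd by (auto dest!: dvd_imp_le)
  then have "1 \<notin> set R" "2 \<notin> set R" using R(5) by blast+
  moreover have "length R \<ge> 1"
    using paths_on_path[OF R(1,3)] by (auto simp: divisor_path_conv Suc_le_eq)
  ultimately show ?thesis
    unfolding admits_even_path_def using R P(2) by (intro exI[of _ Q'] exI[of _ R]) auto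
qed

text \<open>At most \<open>2 * B\<close> primes of \<open>A\<close> are crossed, which leaves
  \<open>p 0, ..., p n\<close>. In fibre \<open>i > 0\<close> the long path is prolonged to run from
  a multiple of \<open>d (i - 1)\<close> to a multiple of \<open>d i\<close>, and the
  \<open>d i\<close> then join consecutive fibres. Fibre \<open>0\<close> supplies only a path with
  an even head, so that the result can enter the next round; the other \<open>n\<close> fibres
  contribute \<open>l\<close> each.\<close>

lemma admits_even_path_step:
  assumes A: "finite A" "\<And>p. p \<in> A \<Longrightarrow> prime p" "\<And>p. p \<in> A \<Longrightarrow> N div p \<le> B"
      "\<And>p p'. p \<in> A \<Longrightarrow> p' \<in> A \<Longrightarrow> p \<noteq> p' \<Longrightarrow> N < p * p'"
    and cardA: "2 * B + n + 1 \<le> card A"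
    and D: "finite D" "\<And>d. d \<in> D \<Longrightarrow> prime d \<and> 2 < d"
      "\<And>d p. d \<in> D \<Longrightarrow> p \<in> A \<Longrightarrow> 2 * d \<le> N div p \<and> N div p < 6 * d \<and> d < p"
      "\<And>d d' p. d \<in> D \<Longrightarrow> d' \<in> D \<Longrightarrow> d \<noteq> d' \<Longrightarrow> p \<in> A \<Longrightarrow> N div p < d * d'"
    and cardD: "n + 23 \<le> card D"
    and IH: "\<And>p. p \<in> A \<Longrightarrow> admits_even_path (N div p) l"
  shows "admits_even_path N (real n * l)"
proof -
  obtain P where P: "paths_on {1..N} P" "card P \<le> F (real N)"
    using optimal_partition_exists by (auto simp: optimal_partition_conv)
  let ?A = "{p \<in> A. \<not> crossed P p}"
  have "card {p \<in> A. crossed P p} \<le> 2 * B"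
    by (rule card_crossed_le[OF P(1)]) (use A in auto)
  moreover have "card A = card {p \<in> A. crossed P p} + card ?A"
    using A(1) by (subst card_Un_disjoint[symmetric]) (auto intro!: arg_cong[of _ _ card])
  ultimately have "n + 1 \<le> card ?A" using cardA by simp
  then obtain A' where A': "A' \<subseteq> ?A" "card A' = n + 1" "finite A'"
    using obtain_subset_with_card_n by blast
  obtain p where p_bij: "bij_betw p {0..<n+1} A'"
    using ex_bij_betw_nat_finite[OF A'(3)] A'(2) by auto
  have pA: "p i \<in> A" "\<not> crossed P (p i)" if "i \<le> n" for i
    using bij_betwE[OF p_bij] that A'(1) by auto
  have p_inj: "p i \<noteq> p j" if "i \<le> n" "j \<le> n" "i \<noteq> j" for i j
    using p_bij that by (auto simp: bij_betw_def inj_on_def)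
  have "\<forall>p\<in>A. \<exists>QC. paths_on {1..N div p} (fst QC) \<and> card (fst QC) \<le> F (real (N div p)) \<and>
      snd QC \<in> fst QC \<and> even (hd (snd QC)) \<and> 1 \<notin> set (snd QC) \<and> 2 \<notin> set (snd QC) \<and>
      l \<le> real (length (snd QC))"
    using IH unfolding admits_even_path_def by fastforce
  then obtain QC where QC: "\<forall>p\<in>A. paths_on {1..N div p} (fst (QC p)) \<and>
      card (fst (QC p)) \<le> F (real (N div p)) \<and> snd (QC p) \<in> fst (QC p) \<and>
      even (hd (snd (QC p))) \<and> 1 \<notin> set (snd (QC p)) \<and> 2 \<notin> set (snd (QC p)) \<and>
      l \<le> real (length (snd (QC p)))"
    by (rule bchoice[THEN exE])
  define Q where "Q p = fst (QC p)" for p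
  define C where "C p = snd (QC p)" for p
  have QC: "paths_on {1..N div p} (Q p)" "card (Q p) \<le> F (real (N div p))" "C p \<in> Q p"
      "even (hd (C p))" "1 \<notin> set (C p)" "2 \<notin> set (C p)" "l \<le> real (length (C p))"
    if "p \<in> A" for p
    using QC that by (simp_all add: Q_def C_def)
  define bad where "bad p = {d \<in> D. crossed (Q p) d \<or> d dvd hd (C p)}" for p
  \<comment> \<open>At most \<open>2 * 5\<close> primes are crossed, as
    \<open>N div p < 6 * d\<close>, and at most one divides \<open>hd (C p)\<close>.\<close>
  have card_bad: "card (bad p) \<le> 11" if p: "p \<in> A" for p
  proof -
    have "card {d \<in> D. crossed (Q p) d} \<le> 2 * 5"
    proof (rule card_crossed_le[OF QC(1)[OF p] D(1)])
      fix d assume "d \<in> D"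
      then have "N div p < 6 * d" using D(3) p by blast
      then have "N div p div d < 6" by (rule less_mult_imp_div_less)
      then show "N div p div d \<le> 5" by simp
    qed (use D(2,4) p in auto)
    moreover have "card {d \<in> D. d dvd hd (C p)} \<le> 1"
    proof -
      have "C p \<noteq> []" using paths_on_path[OF QC(1,3)[OF p]] by (simp add: divisor_path_conv)
      then have hd: "hd (C p) \<in> {1..N div p}" using paths_on_subset[OF QC(1,3)[OF p]] hd_in_set by blast
      have "d = d'" if d: "d \<in> D" "d' \<in> D" "d dvd hd (C p)" "d' dvd hd (C p)" for d d'
      proof (rule ccontr)
        assume "d \<noteq> d'"
        then have "d * d' dvd hd (C p)" using d D(2) primes_coprime divides_mult by blast
        then have "d * d' \<le> hd (C p)" using hd by (intro dvd_imp_le) auto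
        then show False using D(4)[OF d(1,2) \<open>d \<noteq> d'\<close> p] hd by auto
      qed
      then show ?thesis using D(1) by (simp add: card_le_Suc0_iff_eq)
    qed
    moreover have "bad p = {d \<in> D. crossed (Q p) d} \<union> {d \<in> D. d dvd hd (C p)}"
      by (auto simp: bad_def)
    ultimately show ?thesis
      using card_Un_le[of "{d \<in> D. crossed (Q p) d}" "{d \<in> D. d dvd hd (C p)}"] by simp
  qed
  \<comment> \<open>Each \<open>d i\<close> must suit both fibres that it touches, and
    \<open>Suc n + 2 * 11\<close> is the \<open>n + 23\<close> of \<open>cardD\<close>. The last
    one, \<open>d n\<close>, marks the end of fibre \<open>n\<close>; beyond index \<open>n\<close>
    there is no fibre, hence the empty sets.\<close>
  have "\<exists>d. inj_on d {..<Suc n} \<and> (\<forall>i<Suc n. d i \<in> D - (if i \<le> n then bad (p i) else {})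
      - (if Suc i \<le> n then bad (p (Suc i)) else {}))"
    by (rule exists_injective_choice[OF D(1), of _ 11])
      (use cardD card_bad pA in \<open>auto simp: bad_def\<close>)
  then obtain d where d: "inj_on d {..<Suc n}" "\<And>i. i < Suc n \<Longrightarrow>
      d i \<in> D - (if i \<le> n then bad (p i) else {}) - (if Suc i \<le> n then bad (p (Suc i)) else {})"
    by blast
  have d_inj: "inj_on d {..n}" using d(1) by (simp only: lessThan_Suc_atMost)
  have d_mem: "d i \<in> D" and d_bad: "d i \<notin> bad (p i)" if "i \<le> n" for i
    using d(2)[of i] that by auto
  have d_bad_Suc: "d i \<notin> bad (p (Suc i))" if "i < n" for i using d(2)[of i] that by auto
  have good: "\<not> crossed (Q (p i)) (d j)" "\<not> d j dvd hd (C (p i))"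
    if "d j \<notin> bad (p i)" "j \<le> n" for i j
    using that d_mem[of j] by (auto simp: bad_def)
  have "\<forall>i\<in>{..n}. \<exists>QR. paths_on {1..N div p i} (fst QR) \<and> card (fst QR) \<le> F (real (N div p i)) \<and>
    snd QR \<in> fst QR \<and> d i dvd last (snd QR) \<and> (i = 0 \<longrightarrow> even (hd (snd QR))) \<and>
    (i > 0 \<longrightarrow> d (i - 1) dvd hd (snd QR) \<and> l \<le> real (length (snd QR)))"
  proof
    fix i assume "i \<in> {..n}"
    then have i: "i \<le> n" by simp
    note p = pA(1)[OF i]
    show "\<exists>QR. paths_on {1..N div p i} (fst QR) \<and> card (fst QR) \<le> F (real (N div p i)) \<and>
      snd QR \<in> fst QR \<and> d i dvd last (snd QR) \<and> (i = 0 \<longrightarrow> even (hd (snd QR))) \<and>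
      (i > 0 \<longrightarrow> d (i - 1) dvd hd (snd QR) \<and> l \<le> real (length (snd QR)))"
    proof (cases "i = 0")
      case True
      obtain Q' R where R: "paths_on {1..N div p i} Q'" "card Q' \<le> card (Q (p i))" "R \<in> Q'"
        "even (hd R)" "\<forall>x\<in>set R. d i dvd x"
        using exists_even_fibre_path[OF QC(1)[OF p], of "d i"] D(2,3)[OF d_mem[OF i]] p
          good(1)[OF d_bad[OF i] i] by (metis less_trans zero_less_numeral)
      moreover have "R \<noteq> []" using paths_on_path[OF R(1,3)] by (simp add: divisor_path_conv)
      ultimately show ?thesis using True QC(2)[OF p] by (intro exI[of _ "(Q', R)"]) auto
    next
      case False
      then have j: "i - 1 \<le> n" "i - 1 < n" "Suc (i - 1) = i" using i by auto
      have bad: "d (i - 1) \<notin> bad (p i)" using d_bad_Suc[OF j(2)] j(3) by simp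
      have neq: "d (i - 1) \<noteq> d i" using inj_onD[OF d_inj, of "i - 1" i] i j False by auto
      have "\<exists>Q' R. paths_on {1..N div p i} Q' \<and> card Q' \<le> card (Q (p i)) \<and> R \<in> Q' \<and>
          d (i - 1) dvd hd R \<and> d i dvd last R \<and> length (C (p i)) \<le> length R"
        using D(2)[OF d_mem[OF i]] D(2)[OF d_mem[OF j(1)]] D(3)[OF d_mem[OF i] p]
          D(3)[OF d_mem[OF j(1)] p] D(4)[OF d_mem[OF j(1)] d_mem[OF i] neq p]
          good[OF bad j(1)] good[OF d_bad[OF i] i] neq
        by (intro exists_linked_path[OF QC(1,3,4,5,6)[OF p]]) auto
      then obtain Q' R where R: "paths_on {1..N div p i} Q'" "card Q' \<le> card (Q (p i))" "R \<in> Q'"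
          "d (i - 1) dvd hd R" "d i dvd last R" "length (C (p i)) \<le> length R" by blast
      then show ?thesis using False QC(2,7)[OF p] by (intro exI[of _ "(Q', R)"]) auto
    qed
  qed
  then obtain QR where QR: "\<forall>i\<in>{..n}. paths_on {1..N div p i} (fst (QR i)) \<and>
    card (fst (QR i)) \<le> F (real (N div p i)) \<and>
    snd (QR i) \<in> fst (QR i) \<and> d i dvd last (snd (QR i)) \<and> (i = 0 \<longrightarrow> even (hd (snd (QR i)))) \<and>
    (i > 0 \<longrightarrow> d (i - 1) dvd hd (snd (QR i)) \<and> l \<le> real (length (snd (QR i))))"
    by (rule bchoice[THEN exE])
  define Q' where "Q' i = fst (QR i)" for i
  define R where "R i = snd (QR i)" for i
  have QR: "paths_on {1..N div p i} (Q' i)" "card (Q' i) \<le> F (real (N div p i))" "R i \<in> Q' i"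
      "d i dvd last (R i)" "i = 0 \<Longrightarrow> even (hd (R i))" "i > 0 \<Longrightarrow> d (i - 1) dvd hd (R i)"
      "i > 0 \<Longrightarrow> l \<le> real (length (R i))"
    if "i \<le> n" for i
    using bspec[OF QR, of i] that by (simp_all add: Q'_def R_def)
  have "\<exists>P'. paths_on {1..N} P' \<and> card P' \<le> card P \<and> (\<forall>i\<in>{..n}. map ((*) (p i)) ` Q' i \<subseteq> P')"
    using A(2,4) pA p_inj QR(1,2) by (intro replace_fibres[OF P(1)]) auto
  then obtain P' where P': "paths_on {1..N} P'" "card P' \<le> card P"
    "\<And>i. i \<le> n \<Longrightarrow> map ((*) (p i)) ` Q' i \<subseteq> P'" by auto
  define r where "r i = map ((*) (p i)) (R i)" for i
  have r_mem: "r i \<in> P'" if "i \<le> n" for i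
    using P'(3)[OF that] QR(3)[OF that] by (auto simp: r_def)
  have r_path: "divisor_path (r i)" if "i \<le> n" for i
    by (rule paths_on_path[OF P'(1) r_mem[OF that]])
  have R_ne: "R i \<noteq> []" if "i \<le> n" for i
    using r_path[OF that] by (auto simp: r_def divisor_path_conv)
  have r_ge: "p i dvd x" "x > 0" "p i \<le> x" if "i \<le> n" "x \<in> set (r i)" for i x
  proof -
    show "p i dvd x" using that by (auto simp: r_def)
    show "x > 0" using r_path[OF that(1)] that(2) by (auto simp: divisor_path_conv intro: Nat.gr0I)
    show "p i \<le> x" using \<open>p i dvd x\<close> \<open>x > 0\<close> by (rule dvd_imp_le)
  qed
  have d_lt: "d j < p i" "d j > 2" "d j \<le> N" if "i \<le> n" "j \<le> n" for i j
    using D(2)[OF d_mem[OF that(2)]] D(3)[OF d_mem[OF that(2)] pA(1)[OF that(1)]]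
      div_le_dividend[of N "p i"] by linarith+
  have r_disj: "set (r i) \<inter> set (r j) = {}" if "i \<le> n" "j \<le> n" "i \<noteq> j" for i j
  proof -
    have False if x: "x \<in> set (r i)" "x \<in> set (r j)" for x
    proof -
      have "p i * p j dvd x"
        using r_ge(1)[OF \<open>i \<le> n\<close> x(1)] r_ge(1)[OF \<open>j \<le> n\<close> x(2)] A(2)[OF pA(1)[OF \<open>i \<le> n\<close>]]
          A(2)[OF pA(1)[OF \<open>j \<le> n\<close>]] p_inj[OF \<open>i \<le> n\<close> \<open>j \<le> n\<close> \<open>i \<noteq> j\<close>]
          primes_coprime divides_mult by blast
      then have "p i * p j \<le> x" using r_ge(2)[OF \<open>i \<le> n\<close> x(1)] by (rule dvd_imp_le)
      moreover have "x \<le> N" using paths_on_subset[OF P'(1) r_mem[OF \<open>i \<le> n\<close>]] x(1) by auto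
      moreover have "N < p i * p j"
        using A(4) pA(1) p_inj \<open>i \<le> n\<close> \<open>j \<le> n\<close> \<open>i \<noteq> j\<close> by blast
      ultimately show False by simp
    qed
    then show ?thesis by blast
  qed
  \<comment> \<open>Every entry of \<open>r i\<close> is at least \<open>p i > d j\<close>, so the
    connectors lie outside all the glued paths.\<close>
  have dr: "d j \<notin> set (r i)" if "i \<le> n" "j \<le> n" for i j
    using r_ge(3)[OF that(1), of "d j"] d_lt(1)[OF that] by auto
  have "\<exists>X. divisor_path X \<and> set X = d ` {..<n} \<union> (\<Union>i\<le>n. set (r i)) \<and> hd X = hd (r 0) \<and>
    last X = last (r n) \<and> (\<Sum>i\<le>n. length (r i)) \<le> length X"
  proof (rule exists_chain)
    show "inj_on d {..<n}" using d_inj by (auto simp: inj_on_def)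
    show "d i > 0" if "i < n" for i using d_lt(2)[of 0 i] that by simp
    fix i assume i: "i < n"
    then have i': "i \<le> n" "Suc i \<le> n" by auto
    have "last (r i) \<in> set (r i)" "hd (r (Suc i)) \<in> set (r (Suc i))"
      using r_path[OF i'(1)] r_path[OF i'(2)] by (simp_all add: divisor_path_conv)
    then have "d i < last (r i)" "d i < hd (r (Suc i))"
      using r_ge(3)[OF i'(1)] r_ge(3)[OF i'(2)] d_lt(1)[OF i'(1) i'(1)] d_lt(1)[OF i'(2) i'(1)]
      by (meson less_le_trans)+
    moreover have "d i dvd last (r i)"
      using QR(4)[OF i'(1)] R_ne[OF i'(1)] by (simp add: r_def last_map)
    moreover have "d i dvd hd (r (Suc i))"
      using QR(6)[OF i'(2)] R_ne[OF i'(2)] by (simp add: r_def hd_map)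
    ultimately show "divisor_edge (last (r i)) (d i)" "divisor_edge (d i) (hd (r (Suc i)))"
      by (auto simp: divisor_edge_def)
  qed (use r_path r_disj dr in auto)
  then obtain X where X: "divisor_path X" "set X = d ` {..<n} \<union> (\<Union>i\<le>n. set (r i))"
    "hd X = hd (r 0)" "(\<Sum>i\<le>n. length (r i)) \<le> length X" by blast
  have r_inj: "inj_on r {..n}"
  proof (rule inj_onI)
    fix i j assume ij: "i \<in> {..n}" "j \<in> {..n}" "r i = r j"
    have "set (r i) \<noteq> {}" using R_ne[of i] ij(1) by (simp add: r_def)
    then show "i = j" using r_disj[of i j] ij by auto
  qed
  have "\<exists>P''. paths_on {1..N} P'' \<and> card P'' \<le> card P' \<and> X \<in> P''"
  proof (rule paths_on_surgery[OF P'(1), of "d ` {..<n}" "r ` {..n}"])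
    have "inj_on d {..<n}" using d_inj by (auto simp: inj_on_def)
    then show "card (r ` {..n}) = Suc (card (d ` {..<n}))" using r_inj by (simp add: card_image)
    show "d ` {..<n} \<subseteq> {1..N}" 
    proof
      fix x assume "x \<in> d ` {..<n}"
      then obtain i where i: "i < n" "x = d i" by blast
      then show "x \<in> {1..N}" using d_lt(2,3)[of 0 i] by simp
    qed
    show "set q \<inter> d ` {..<n} = {}" if "q \<in> r ` {..n}" for q using that dr by auto
    show "set X = d ` {..<n} \<union> (\<Union>q\<in>r ` {..n}. set q)" using X(2) by auto
  qed (use r_mem X(1) in auto)
  then obtain P'' where P'': "paths_on {1..N} P''" "card P'' \<le> card P'" "X \<in> P''" by blast
  have "even (hd X)" using QR(5)[of 0] R_ne[of 0] X(3) by (simp add: r_def hd_map)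
  moreover have X_gt: "x > 2" if "x \<in> set X" for x
  proof -
    have "2 < x" if "i \<le> n" "x \<in> set (r i)" for i
      using r_ge(3)[OF that] d_lt(1,2)[OF that(1) that(1)] by linarith
    then show ?thesis using that d_lt(2)[of 0] unfolding X(2) by auto
  qed
  then have "1 \<notin> set X" "2 \<notin> set X" by fastforce+
  moreover have "real n * l \<le> real (length X)"
  proof -
    \<comment> \<open>The sum starts at \<open>1\<close>, since fibre \<open>0\<close> carries no
      bound on its length.\<close>
    have "real n * l = (\<Sum>i\<in>{1..n}. l)" by simp
    also have "\<dots> \<le> (\<Sum>i\<in>{1..n}. real (length (r i)))"
      using QR(7) by (intro sum_mono) (auto simp: r_def)
    also have "\<dots> \<le> (\<Sum>i\<le>n. real (length (r i)))" by (intro sum_mono2) auto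
    also have "\<dots> \<le> real (length X)" using X(4) by (metis of_nat_le_iff of_nat_sum)
    finally show ?thesis .
  qed
  ultimately show ?thesis
    unfolding admits_even_path_def using P'' P'(2) P(2) by (intro exI[of _ P''] exI[of _ X]) auto
qed

section \<open>Prime windows meeting the requirements of the recursion step\<close>

lemma admits_even_path_mono: "admits_even_path N l \<Longrightarrow> l' \<le> l \<Longrightarrow> admits_even_path N l'"
  unfolding admits_even_path_def using order.trans by blast

text \<open>The product is at least \<open>(m + 1) * (m + 1)\<close>, and \<open>m >= 5\<close>
  makes one factor at least \<open>6\<close>.\<close>

lemma less_mult_of_gt:
  fixes m d d' :: nat
  assumes "m \<ge> 5" "y < 6 * (m + 1)" "m < d" "m < d'"
  shows "y < d * d'"
proof -
  have "6 * (m + 1) \<le> (m + 1) * (m + 1)" using assms(1) by (intro mult_le_mono1) simp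
  also have "\<dots> \<le> d * d'" using assms by (intro mult_le_mono) auto
  finally show ?thesis using assms(2) by simp
qed

lemma eventually_card_primes_ge_const:
  "\<forall>\<^sub>F n in sequentially. c \<le> card {p \<in> {n<..2*n}. prime p}"
proof -
  have "\<forall>\<^sub>F n in sequentially. real c \<le> real n / (10 * ln (real n))" by real_asymp
  then show ?thesis using eventually_card_primes_ge by eventually_elim linarith
qed

lemma eventually_admits_even_path: "\<forall>\<^sub>F N in sequentially. admits_even_path N 1"
proof -
  have "filterlim (\<lambda>N::nat. N div 4) sequentially sequentially"
    by (intro filterlim_at_top_div_const_nat) simp
  then have "\<forall>\<^sub>F N in sequentially. 11 \<le> card {p \<in> {N div 4<..2*(N div 4)}. prime p}"
    by (rule eventually_compose_filterlim[OF eventually_card_primes_ge_const])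
  then show ?thesis using eventually_ge_at_top[of 20]
  proof eventually_elim
    case (elim N)
    \<comment> \<open>With this \<open>m\<close>, every \<open>d\<close> in \<open>(m, 2 m]\<close>
      satisfies \<open>2 * d <= 4 * m <= N\<close> and
      \<open>N < 4 * (m + 1) < 6 * d\<close>.\<close>
    define m where "m = N div 4"
    have m: "5 \<le> m" "4 * m \<le> N" "N < 4 * (m + 1)" using elim(2) unfolding m_def by presburger+
    show ?case
    proof (rule admits_even_path_base)
      show "11 \<le> card {p \<in> {m<..2*m}. prime p}" using elim(1) by (simp add: m_def)
      fix d assume d: "d \<in> {p \<in> {m<..2*m}. prime p}"
      have "N < 6 * (m + 1)" using m(3) by simp
      then show "N < d * d'" if "d' \<in> {p \<in> {m<..2*m}. prime p}" for d'
        by (rule less_mult_of_gt[OF m(1)]) (use d that in simp_all)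
      have "m < d" "d \<le> 2 * m" using d by simp_all
      then show "prime d \<and> 2 < d \<and> 2 * d \<le> N \<and> N < 6 * d"
        using d m by (intro conjI; (linarith | simp))
    qed simp
  qed
qed

text \<open>\<open>N div p\<close> may vary by a factor of at most \<open>3 / 2\<close> if an interval \<open>(m, 2 m]\<close> is to fit between
  \<open>N div p / 6\<close> and \<open>N div p / 2\<close> for all \<open>p\<close>; hence \<open>p\<close> is confined to \<open>(2 w, 3 w]\<close> or \<open>(3 w, 4 w]\<close>.\<close>

lemma admits_even_path_step_windows:
  fixes N w a m n :: nat
  assumes w: "w > 0" "N \<le> w * w" and a: "a = 2 \<or> a = 3"
    and m: "m = N div ((a + 1) * w) div 4" "m \<ge> 5"
    and A: "2 * (N div (2 * w)) + n + 1 \<le> card {p \<in> {a * w<..(a + 1) * w}. prime p}"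
    and D: "n + 23 \<le> card {p \<in> {m<..2 * m}. prime p}"
    and IH: "\<And>y. N div ((a + 1) * w) \<le> y \<Longrightarrow> y \<le> N div (2 * w) \<Longrightarrow> admits_even_path y l"
  shows "admits_even_path N (real n * l)"
proof (rule admits_even_path_step)
  let ?A = "{p \<in> {a * w<..(a + 1) * w}. prime p}" and ?D = "{p \<in> {m<..2 * m}. prime p}"
  define Y where "Y = N div ((a + 1) * w)"
  have Y: "4 * m \<le> Y" "Y < 4 * (m + 1)" using m(1) unfolding Y_def[symmetric] by presburger+
  have p_gt: "2 * w < p" if "p \<in> ?A" for p
    using that a by auto
  have y_ge: "Y \<le> N div p" if "p \<in> ?A" for p
    unfolding Y_def using that by (intro div_le_mono2) auto
  have y_le: "N div p \<le> N div (2 * w)" if "p \<in> ?A" for p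
    using p_gt[OF that] w by (intro div_le_mono2) auto
  \<comment> \<open>From \<open>p > a * w\<close> and \<open>N < 4 * (m + 1) * (a + 1) * w\<close>
    the quotient is below \<open>4 * (m + 1) * (a + 1) / a\<close>, and \<open>(a + 1) / a\<close>
    is at most \<open>3 / 2\<close>.\<close>
  have y_less: "N div p < 6 * (m + 1)" if "p \<in> ?A" for p
  proof -
    have "N < (Y + 1) * ((a + 1) * w)"
      using dividend_less_div_times[of "(a + 1) * w" N] w unfolding Y_def by (simp add: algebra_simps)
    also have "\<dots> \<le> 4 * (m + 1) * ((a + 1) * w)" using Y by (intro mult_le_mono1) simp
    finally have N: "N < (4 * (m + 1) * (a + 1)) * w" by (simp only: mult_ac)
    have "(N div p * a) * w \<le> N div p * p" using that by (simp add: mult.assoc)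
    also have "\<dots> \<le> N" by simp
    finally have "(N div p * a) * w < (4 * (m + 1) * (a + 1)) * w" using N by linarith
    then have "N div p * a < 4 * (m + 1) * (a + 1)" by simp
    then show ?thesis using a by auto
  qed
  show "admits_even_path (N div p) l" if "p \<in> ?A" for p
    using IH y_ge[OF that] y_le[OF that] unfolding Y_def by simp
  show "N div p \<le> N div (2 * w)" if "p \<in> ?A" for p by (rule y_le[OF that])
  show "N < p * p'" if "p \<in> ?A" "p' \<in> ?A" for p p'
  proof -
    have "N < (w + 1) * (w + 1)" using w by simp
    also have "\<dots> \<le> p * p'" using p_gt[OF that(1)] p_gt[OF that(2)] w by (intro mult_le_mono) auto
    finally show ?thesis .
  qed
  show "N div p < d * d'" if "d \<in> ?D" "d' \<in> ?D" "p \<in> ?A" for d d' p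
    by (rule less_mult_of_gt[OF m(2) y_less[OF that(3)]]) (use that(1,2) in simp_all)
  show "2 * d \<le> N div p \<and> N div p < 6 * d \<and> d < p" if d: "d \<in> ?D" and p: "p \<in> ?A" for d p
  proof -
    have "2 * d \<le> N div p" using d Y y_ge[OF p] by simp
    moreover have "N div p < 6 * d" using d y_less[OF p] by simp
    moreover have "N div p \<le> w"
    proof -
      have "N div p \<le> w * w div p" using w by (intro div_le_mono)
      also have "\<dots> \<le> w * w div w" using p_gt[OF p] w by (intro div_le_mono2) auto
      finally show ?thesis using w by simp
    qed
    ultimately show ?thesis using p_gt[OF p] by linarith
  qed
qed (use A D m(2) in auto)

text \<open>With \<open>w\<close> of order \<open>sqrt (N * ln N)\<close> there are at least
  \<open>8 * B\<close> primes in \<open>(2 w, 4 w]\<close>, where \<open>B = N div (2 * w)\<close>,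
  so one half of that interval has \<open>4 * B\<close> of them. Then \<open>n\<close> is at least
  of order \<open>m / ln m\<close> and the quotients of order \<open>N / w\<close>, so the product
  is at least of order \<open>N / (ln N)^2\<close>.\<close>

lemma eventually_windows:
  "\<forall>\<^sub>F N in sequentially. \<exists>w a m n. w > 0 \<and> N \<le> w * w \<and> (a = 2 \<or> a = 3) \<and>
     m = N div ((a + 1) * w) div 4 \<and> m \<ge> M \<and>
     2 * (N div (2 * w)) + n + 1 \<le> card {p \<in> {a * w<..(a + 1) * w}. prime p} \<and>
     n + 23 \<le> card {p \<in> {m<..2 * m}. prime p} \<and>
     real N / (200000 * (ln (real N))\<^sup>2) \<le> real n * real (N div ((a + 1) * w))"
proof -
  obtain n0 where n0: "\<And>n. n \<ge> n0 \<Longrightarrow> real n / (10 * ln (real n)) \<le> real (card {p \<in> {n<..2*n}. prime p})"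
    using eventually_card_primes_ge unfolding eventually_sequentially by blast
  have "\<forall>\<^sub>F m in sequentially. 48 \<le> real m / (20 * ln (real m))" by real_asymp
  then obtain n1 where n1: "\<And>m. m \<ge> n1 \<Longrightarrow> 48 \<le> real m / (20 * ln (real m))"
    unfolding eventually_sequentially by blast
  define n2 where "n2 = real (n0 + n1 + M + 5)"
  \<comment> \<open>The first condition gives \<open>2 * w <= N\<close>, the second keeps
    \<open>m\<close> above all thresholds, and the third does the same for \<open>w\<close>.\<close>
  have ev1: "\<forall>\<^sub>F N in sequentially. 6 * sqrt (real N * ln (real N)) \<le> real N / 2" by real_asymp
  have ev2: "\<forall>\<^sub>F N in sequentially. n2 \<le> real N / (16 * (6 * sqrt (real N * ln (real N)))) - 1"
    by real_asymp
  have ev3: "\<forall>\<^sub>F N in sequentially. n2 + 1 \<le> sqrt (real N * ln (real N))"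
    by real_asymp
  have ev4: "\<forall>\<^sub>F N in sequentially. 1 \<le> ln (real N)" by real_asymp
  show ?thesis
    using ev1 ev2 ev3 ev4 eventually_ge_at_top[of 3]
  proof eventually_elim
    case (elim N)
    define s where "s = sqrt (real N * ln (real N))"
    note elim = elim[folded s_def]
    \<comment> \<open>The factor \<open>5\<close> ensures \<open>w * w >= 20 * s * s\<close>, needed
      below to have \<open>8 * B\<close> primes.\<close>
    define w where "w = nat \<lceil>5 * s\<rceil>"
    have N: "real N \<ge> 3" using elim by simp
    have n2: "n2 \<ge> 5" "n2 \<ge> real n0" "n2 \<ge> real n1" "n2 \<ge> real M" by (auto simp: n2_def)
    have s: "s \<ge> 6" using elim(3) n2 by linarith
    have s2: "s * s = real N * ln (real N)"
      using elim(4) by (simp add: s_def flip: power2_eq_square)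
    have w: "5 * s \<le> real w" "real w \<le> 6 * s" using s unfolding w_def by linarith+
    have w0: "w > 0" using w s by (auto intro!: Nat.gr0I)
    have N_le: "real N \<le> s * s" using elim(4) N unfolding s2 by (simp add: mult_le_cancel_left1)
    have "real N \<le> real w * real w"
      using N_le mult_mono[of s "real w" s "real w"] w s by linarith
    then have Nw: "N \<le> w * w" by (metis of_nat_le_iff of_nat_mult)
    have lnw: "ln (real (2 * w)) \<le> ln (real N)"
      using w elim(1) w0 N by (subst ln_le_cancel_iff) auto
    have lnw0: "ln (real (2 * w)) > 0" using w s by (intro ln_gt_zero) auto
    let ?pr = "\<lambda>a b. {p \<in> {a<..b}. prime (p::nat)}"
    let ?B = "N div (2 * w)"
    have B: "real ?B \<le> real N / (2 * real w)"
      using of_nat_div_le_of_nat[of N "2 * w", where ?'a = real] by simp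
    have "4 * real ?B \<le> real (2 * w) / (10 * ln (real (2 * w))) / 2"
    proof -
      have "40 * real ?B * ln (real (2 * w)) \<le> 40 * (real N / (2 * real w)) * ln (real N)"
        using B lnw lnw0 by (intro mult_mono) auto
      also have "\<dots> = 20 * (s * s) / real w" unfolding s2 using w0 by (simp add: field_simps)
      also have "\<dots> \<le> real w"
      proof -
        have "20 * (s * s) \<le> (5 * s) * (5 * s)" by simp
        also have "\<dots> \<le> real w * real w" using w s by (intro mult_mono) auto
        finally show ?thesis using w0 by (simp add: field_simps)
      qed
      finally show ?thesis using lnw0 by (simp add: field_simps)
    qed
    also have "\<dots> \<le> real (card (?pr (2 * w) (4 * w))) / 2"
    proof -
      have "2 * w \<ge> n0" using w s n2 elim(3) by linarith
      from n0[OF this] show ?thesis by simp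
    qed
    finally have "8 * real ?B \<le> real (card (?pr (2 * w) (4 * w)))" by simp
    also have "?pr (2 * w) (4 * w) = ?pr (2 * w) ((2 + 1) * w) \<union> ?pr (3 * w) ((3 + 1) * w)"
      using w0 by auto
    also have "card \<dots> \<le> card (?pr (2 * w) ((2 + 1) * w)) + card (?pr (3 * w) ((3 + 1) * w))"
      by (rule card_Un_le)
    finally have "8 * real ?B \<le>
        real (card (?pr (2 * w) ((2 + 1) * w)) + card (?pr (3 * w) ((3 + 1) * w)))" by simp
    then have "4 * ?B \<le> card (?pr (2 * w) ((2 + 1) * w)) \<or> 4 * ?B \<le> card (?pr (3 * w) ((3 + 1) * w))"
      by linarith
    then have "\<exists>a. (a = 2 \<or> a = 3) \<and> 4 * ?B \<le> card (?pr (a * w) ((a + 1) * w))" by blast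
    then obtain a where a: "a = 2 \<or> a = 3" "4 * ?B \<le> card (?pr (a * w) ((a + 1) * w))" by blast
    define Y where "Y = N div ((a + 1) * w)"
    define m where "m = Y div 4"
    define n where "n = card (?pr m (2 * m)) - 23"
    have m_ge: "real N / (16 * real w) - 1 \<le> real m"
    proof -
      have "N div (16 * w) \<le> m"
        unfolding m_def Y_def div_mult2_eq[symmetric] using a w0 by (intro div_le_mono2) auto
      moreover have "real N / real (16 * w) - 1 \<le> real (N div (16 * w))"
      proof -
        have "N \<le> (N div (16 * w) + 1) * (16 * w)"
          using dividend_less_div_times[of "16 * w" N] w0 by (simp add: algebra_simps)
        then have "real N \<le> real (N div (16 * w) + 1) * real (16 * w)"
          by (metis of_nat_le_iff of_nat_mult)
        then show ?thesis using w0 by (simp add: field_simps)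
      qed
      ultimately show ?thesis by simp
    qed
    have "real N / (16 * (6 * s)) \<le> real N / (16 * real w)"
      using w w0 by (intro divide_left_mono) auto
    then have m: "real m \<ge> n2" and m_half: "real N / (32 * real w) \<le> real m"
      using m_ge elim(2) n2 by (auto simp: field_simps)
    have mM: "m \<ge> M" "m \<ge> n0" "m \<ge> n1" "m \<ge> 5" using m n2 by linarith+
    have mY: "4 * m \<le> Y" "m \<le> N" unfolding m_def Y_def by (auto intro: order.trans[OF div_le_dividend])
    have lnm: "0 < ln (real m)" "ln (real m) \<le> ln (real N)"
      using mM mY N by (auto intro!: ln_gt_zero)
    have card_le: "card (?pr m (2 * m)) \<le> m"
    proof -
      have "card (?pr m (2 * m)) \<le> card {m<..2*m}" by (intro card_mono) auto
      then show ?thesis by simp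
    qed
    have n_ge: "real m / (20 * ln (real m)) \<le> real n" "23 \<le> card (?pr m (2 * m))"
    proof -
      have "real m / (10 * ln (real m)) = real m / (20 * ln (real m)) + real m / (20 * ln (real m))"
        by simp
      \<comment> \<open>One half of the prime count bound is kept; the other half, at least
        \<open>48\<close>, absorbs the \<open>23\<close> subtracted in \<open>n\<close>.\<close>
      then have "real m / (20 * ln (real m)) + 48 \<le> real (card (?pr m (2 * m)))"
        using n0[OF mM(2)] n1[OF mM(3)] by linarith
      moreover have "real m / (20 * ln (real m)) \<ge> 0" using lnm by simp
      ultimately show "23 \<le> card (?pr m (2 * m))" "real m / (20 * ln (real m)) \<le> real n"
        unfolding n_def by linarith+
    qed
    \<comment> \<open>Here \<open>n + 1 <= 4 * m <= Y <= B\<close>, so the \<open>4 * B\<close>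
      primes suffice for \<open>2 * B + n + 1\<close>.\<close>
    have "Y \<le> ?B" unfolding Y_def using a w0 by (intro div_le_mono2) auto
    then have cardA: "2 * ?B + n + 1 \<le> card (?pr (a * w) ((a + 1) * w))"
      using a(2) card_le mY(1) mM(4) unfolding n_def by linarith
    \<comment> \<open>Combining \<open>m >= N / (32 * w)\<close>,
      \<open>n >= m / (20 * ln m)\<close> and \<open>Y >= 4 * m\<close> gives the denominator
      \<open>5120 * w * w * ln N\<close>; with \<open>w * w <= 36 * N * ln N\<close> the constant is
      \<open>184320 < 200000\<close>.\<close>
    have "real N / (200000 * (ln (real N))\<^sup>2) \<le> real n * real Y"
    proof -
      have w2: "real w * real w \<le> 36 * (real N * ln (real N))"
        using mult_mono[OF w(2) w(2)] w s unfolding s2[symmetric] by simp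
      have "real N / (200000 * (ln (real N))\<^sup>2) \<le>
          real N * real N / (5120 * (36 * (real N * ln (real N))) * ln (real N))"
        using N elim(4) by (simp add: field_simps power2_eq_square)
      also have "\<dots> \<le> real N * real N / (5120 * (real w * real w) * ln (real N))"
        using w2 w0 elim(4) N by (intro divide_left_mono mult_right_mono mult_left_mono mult_pos_pos) auto
      also have "\<dots> = (real N / (32 * real w)) * (real N / (32 * real w)) / (5 * ln (real N))"
        using w0 by (simp add: field_simps)
      also have "\<dots> \<le> real m * real m / (5 * ln (real N))"
        using m_half elim(4) by (intro divide_right_mono mult_mono) auto
      also have "\<dots> \<le> real m * real m / (5 * ln (real m))"
        using lnm by (intro divide_left_mono) auto
      also have "\<dots> = real m / (20 * ln (real m)) * (4 * real m)" by simp
      also have "\<dots> \<le> real n * real Y"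
        using n_ge(1) mY(1) lnm by (intro mult_mono) auto
      finally show ?thesis .
    qed
    moreover have "n + 23 \<le> card (?pr m (2 * m))" using n_ge(2) by (simp add: n_def)
    ultimately show ?case
      using w0 Nw a(1) mM(1) cardA unfolding m_def Y_def by blast
  qed
qed

section \<open>Solving the recursion\<close>

definition loss :: "real \<Rightarrow> real \<Rightarrow> real" where
  "loss A x = ln x powr A * exp ((ln (ln x))\<^sup>2 / ln 2)"

lemma ln_gt_1:
  assumes "x \<ge> (3::real)"
  shows "ln x > 1"
proof -
  have "exp 1 < x" using e_less_272 assms by linarith
  then have "ln (exp 1) < ln x" using assms by (subst ln_less_cancel_iff) auto
  then show ?thesis by simp
qed

lemma loss_pos: "x \<ge> 3 \<Longrightarrow> loss A x > 0"
  using ln_gt_1[of x] by (simp add: loss_def)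

text \<open>With \<open>u = ln (ln N)\<close>, passing from \<open>N\<close> to \<open>sqrt N\<close> replaces \<open>u\<close> by \<open>u - ln 2\<close>, and
  \<open>u\<^sup>2 / ln 2 - (u - ln 2)\<^sup>2 / ln 2 = 2 u - ln 2\<close> pays exactly for a factor \<open>(ln N)\<^sup>2\<close>.\<close>

lemma loss_sqrt_le:
  assumes y: "y \<ge> 3" "y * y \<le> x" and A: "A \<ge> 0"
  shows "loss A y * (ln x)\<^sup>2 * 2 powr (A - 1) \<le> loss A x"
proof -
  have x: "x \<ge> 3" using y mult_mono[of 1 y 3 y] by simp
  define u where "u = ln (ln x)"
  define v where "v = ln (ln y)"
  have lnx: "ln x > 1" "ln y > 1" using ln_gt_1 x y by auto
  have "2 * ln y = ln (y * y)" using y by (simp add: ln_mult)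
  also have "\<dots> \<le> ln x" using y x by (subst ln_le_cancel_iff) auto
  finally have "ln (2 * ln y) \<le> ln (ln x)" using lnx by (subst ln_le_cancel_iff) auto
  \<comment> \<open>Nonnegativity of \<open>v\<close>, which comes from \<open>y >= 3\<close>, is
    what permits squaring the first inequality.\<close>
  then have v: "v \<le> u - ln 2" "v \<ge> 0" using lnx by (auto simp: u_def v_def ln_mult)
  have "v\<^sup>2 \<le> (u - ln 2)\<^sup>2" using v by (intro power_mono) auto
  then have "v\<^sup>2 / ln 2 \<le> (u - ln 2)\<^sup>2 / ln 2" by (intro divide_right_mono) auto
  also have "\<dots> = u\<^sup>2 / ln 2 - 2 * u + ln 2" by (simp add: power2_eq_square field_simps)
  finally have "A * v + v\<^sup>2 / ln 2 \<le> A * (u - ln 2) + (u\<^sup>2 / ln 2 - 2 * u + ln 2)"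
    using v A by (intro add_mono mult_left_mono) auto
  then have "A * v + v\<^sup>2 / ln 2 + 2 * u + (A - 1) * ln 2 \<le> A * u + u\<^sup>2 / ln 2"
    by (simp add: algebra_simps)
  then have "exp (A * v + v\<^sup>2 / ln 2 + 2 * u + (A - 1) * ln 2) \<le> exp (A * u + u\<^sup>2 / ln 2)" by simp
  moreover have "(ln x)\<^sup>2 = exp (2 * u)"
    using lnx by (simp add: u_def exp_double)
  moreover have "loss A x = exp (A * u + u\<^sup>2 / ln 2)" "loss A y = exp (A * v + v\<^sup>2 / ln 2)"
    using lnx by (simp_all add: loss_def powr_def exp_add u_def v_def)
  moreover have "2 powr (A - 1) = exp ((A - 1) * ln 2)" by (simp add: powr_def)
  ultimately show ?thesis by (simp add: exp_add)
qed

lemma loss_mono: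
  assumes "3 \<le> y" "y \<le> x" "A \<ge> 0"
  shows "loss A y \<le> loss A x"
proof -
  have "ln y \<le> ln x" "ln y > 1" using assms ln_gt_1 by auto
  moreover from this have "ln (ln y) \<le> ln (ln x)" "ln (ln y) \<ge> 0" by auto
  ultimately show ?thesis unfolding loss_def using assms(3)
    by (intro mult_mono powr_mono2 exp_le_cancel_iff[THEN iffD2] divide_right_mono power_mono) auto
qed

theorem mainTheorem1:
  shows "\<exists>A::real. A \<ge> 0 \<and> (\<forall>N::nat. N \<ge> 3 \<longrightarrow>
    real (L N) \<ge> real N / (ln (real N) powr A * exp ((ln (ln (real N)))\<^sup>2 / ln 2)))"
proof -
  obtain N0 where N0: "\<And>N. N \<ge> N0 \<Longrightarrow> admits_even_path N 1"
    using eventually_admits_even_path unfolding eventually_sequentially by blast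
  obtain N1 where N1: "\<And>N. N \<ge> N1 \<Longrightarrow> \<exists>w a m n. w > 0 \<and> N \<le> w * w \<and> (a = 2 \<or> a = 3) \<and>
     m = N div ((a + 1) * w) div 4 \<and> m \<ge> N0 + 5 \<and>
     2 * (N div (2 * w)) + n + 1 \<le> card {p \<in> {a * w<..(a + 1) * w}. prime p} \<and>
     n + 23 \<le> card {p \<in> {m<..2 * m}. prime p} \<and>
     real N / (200000 * (ln (real N))\<^sup>2) \<le> real n * real (N div ((a + 1) * w))"
    using eventually_windows[of "N0 + 5"] unfolding eventually_sequentially by blast
  \<comment> \<open>\<open>19\<close> makes \<open>2 powr (A - 1)\<close> at least
    \<open>2 ^ 18 > 200000\<close>; the other term makes \<open>(ln 3) powr A\<close> at least
    \<open>N0 + N1 + 3\<close>, so the bound drops to at most \<open>1\<close> for all small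
    \<open>N\<close>.\<close>
  define A where "A = max 19 (ln (real (N0 + N1 + 3)) / ln (ln 3))"
  have ln3: "ln (ln (3::real)) > 0" using ln_gt_1[of 3] by (intro ln_gt_zero) auto
  have A: "A \<ge> 19" "ln (real (N0 + N1 + 3)) \<le> A * ln (ln 3)"
    using ln3 by (auto simp: A_def field_simps max_def)
  have small: "real N / loss A (real N) \<le> 1" if "3 \<le> N" "N \<le> N0 + N1 + 3" for N
  proof -
    have "real N \<le> exp (ln (real (N0 + N1 + 3)))" using that by simp
    also have "\<dots> \<le> exp (A * ln (ln 3))" by (subst exp_le_cancel_iff) (rule A(2))
    also have "\<dots> \<le> loss A 3"
      using ln_gt_1[of 3] by (simp add: loss_def powr_def mult_le_cancel_left1)
    also have "\<dots> \<le> loss A (real N)" using that A by (intro loss_mono) auto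
    finally show ?thesis using loss_pos[of "real N" A] that by simp
  qed
  have main: "admits_even_path N (real N / loss A (real N))" if "N0 \<le> N" "3 \<le> N" for N
    using that
  proof (induction N rule: less_induct)
    case (less N)
    show ?case
    proof (cases "N \<le> N0 + N1 + 3")
      case True
      then show ?thesis using N0[OF less.prems(1)] small[OF less.prems(2)] admits_even_path_mono by blast
    next
      case False
      then obtain w a m n where w: "w > 0" "N \<le> w * w" "a = 2 \<or> a = 3"
         and m: "m = N div ((a + 1) * w) div 4" "m \<ge> N0 + 5"
         and card: "2 * (N div (2 * w)) + n + 1 \<le> card {p \<in> {a * w<..(a + 1) * w}. prime p}"
           "n + 23 \<le> card {p \<in> {m<..2 * m}. prime p}"
         and n: "real N / (200000 * (ln (real N))\<^sup>2) \<le> real n * real (N div ((a + 1) * w))"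
        using N1[of N] by auto
      define Y where "Y = N div ((a + 1) * w)"
      \<comment> \<open>A common bound for \<open>loss A y\<close> over all quotients
        \<open>y\<close>, since \<open>y * y <= N\<close>. The step needs one length for all fibres,
        and \<open>Y / K\<close> with the smallest quotient \<open>Y\<close> serves.\<close>
      define K where "K = loss A (real N) / ((ln (real N))\<^sup>2 * 2 powr (A - 1))"
      have lnN: "ln (real N) > 1" using less.prems by (intro ln_gt_1) auto
      have K0: "K > 0" unfolding K_def using lnN less.prems by (intro divide_pos_pos loss_pos) auto
      have Y: "Y \<ge> N0" "Y \<ge> 3" using m unfolding Y_def[symmetric] by linarith+
      have "admits_even_path N (real n * (real Y / K))"
      proof (rule admits_even_path_step_windows[OF w m(1) _ card])
        show "m \<ge> 5" using m by simp
        fix y assume y: "N div ((a + 1) * w) \<le> y" "y \<le> N div (2 * w)"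
        have "y \<le> w" "y * w \<le> N"
        proof -
          have "y * (2 * w) \<le> N" using y(2) w(1) by (simp add: less_eq_div_iff_mult_less_eq)
          then show "y * w \<le> N" by simp
          then have "y * w \<le> w * w" using w(2) by linarith
          then show "y \<le> w" using w(1) by simp
        qed
        then have "y * y \<le> N" by (meson mult_le_mono2 order.trans)
        have y3: "Y \<le> y" "N0 \<le> y" "3 \<le> y" using y(1) Y unfolding Y_def by auto
        have "y < N"
          using \<open>y * y \<le> N\<close> y3 mult_le_mono1[of 3 y y] by linarith
        then have IH: "admits_even_path y (real y / loss A (real y))"
          using less.IH y3 by blast
        have "loss A (real y) * (ln (real N))\<^sup>2 * 2 powr (A - 1) \<le> loss A (real N)"
          using \<open>y * y \<le> N\<close> y3 A by (intro loss_sqrt_le) (auto simp flip: of_nat_mult)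
        then have "loss A (real y) \<le> K" unfolding K_def using lnN by (simp add: field_simps)
        then have "real Y / K \<le> real y / loss A (real y)"
          using y3 loss_pos[of "real y" A] by (intro frac_le) auto
        then show "admits_even_path y (real Y / K)" using IH admits_even_path_mono by blast
      qed
      moreover have "real N / loss A (real N) \<le> real n * (real Y / K)"
      proof -
        \<comment> \<open>The factor \<open>2 powr (A - 1)\<close> gained in
          \<open>loss_sqrt_le\<close> pays for the constant \<open>200000\<close> lost in the
          recursion.\<close>
        have "(2::real) powr 18 \<le> 2 powr (A - 1)" using A by (intro powr_mono) auto
        then have pow: "200000 \<le> (2::real) powr (A - 1)" by simp
        have "real N / loss A (real N) = real N / (ln (real N))\<^sup>2 / 2 powr (A - 1) / K"
          using lnN loss_pos[of "real N" A] less.prems by (simp add: K_def)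
        also have "\<dots> \<le> real N / (ln (real N))\<^sup>2 / 200000 / K"
          using pow K0 by (intro divide_right_mono divide_left_mono) auto
        also have "\<dots> \<le> real n * real Y / K"
          using n K0 unfolding Y_def by (intro divide_right_mono) (auto simp: field_simps)
        finally show ?thesis by simp
      qed
      ultimately show ?thesis by (rule admits_even_path_mono)
    qed
  qed
  have "real N / loss A (real N) \<le> real (L N)" if "N \<ge> 3" for N
  proof (cases "N \<ge> N0")
    case True
    then show ?thesis using L_ge[OF main] that by simp
  next
    case False
    then show ?thesis using small[of N] L_ge_1[of N] that by simp
  qed
  then show ?thesis using A(1) by (intro exI[of _ A]) (auto simp: loss_def)
qed

end
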